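(* Let $k\ge 3$ be an odd integer and let $n\ge 7k-4$ be an integer. Let $G$ be a connected graph on $n$ vertices with at most $\left(1+\frac{1}{36k^2}\right)n$ edges. Then $r(G,C_k)=2n-1$.
   Context: All graphs are finite and simple. For graphs $H_1,H_2$, the Ramsey number $r(H_1,H_2)$ is the smallest positive integer $N$ such that every graph $\Gamma$ on $N$ vertices contains $H_1$ as a (not necessarily induced) subgraph or its complement $\overline{\Gamma}$ contains $H_2$ as a subgraph. $C_k$ is the cycle on $k$ vertices. *)

theory Defs
  imports Complex_Main "Graph_Theory.Graph_Theory"
begin

text \<open>
  A finite simple graph is a \<^locale>\<open>pair_graph\<close>: a finite vertex set together with a finite,
  symmetric, irreflexive set of arcs on it. An undirected edge is thus represented by two
  opposite arcs, so edges have to be counted as two-element vertex sets.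
\<close>

definition edges :: "'a pair_pre_digraph \<Rightarrow> 'a set set" where
  "edges G = {{u, v} | u v. (u, v) \<in> parcs G}"

definition complement_graph :: "'a pair_pre_digraph \<Rightarrow> 'a pair_pre_digraph" where
  "complement_graph G =
     \<lparr>pverts = pverts G,
      parcs = {(u, v). u \<in> pverts G \<and> v \<in> pverts G \<and> u \<noteq> v \<and> (u, v) \<notin> parcs G}\<rparr>"

text \<open>Only meaningful for \<open>k \<ge> 3\<close>; for \<open>k = 1\<close> it has a loop.\<close>

definition cycle_graph :: "nat \<Rightarrow> nat pair_pre_digraph" where
  "cycle_graph k =
     \<lparr>pverts = {..<k},
      parcs = {(i, j). i < k \<and> j < k \<and> (j = (i + 1) mod k \<or> i = (j + 1) mod k)}\<rparr>"

definition contains_subgraph :: "'a pair_pre_digraph \<Rightarrow> 'b pair_pre_digraph \<Rightarrow> bool" where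
  "contains_subgraph \<Gamma> H \<longleftrightarrow>
     (\<exists>K :: 'a pair_pre_digraph.
        subgraph (with_proj K) (with_proj \<Gamma>) \<and> digraph_iso (with_proj H) (with_proj K))"

text \<open>
  Host graphs may be taken on vertices of type \<^typ>\<open>nat\<close>, since every finite graph is isomorphic
  to one of these.
\<close>

definition ramsey_number :: "'a pair_pre_digraph \<Rightarrow> 'b pair_pre_digraph \<Rightarrow> nat" where
  "ramsey_number H1 H2 =
     (LEAST N. 0 < N \<and>
        (\<forall>\<Gamma> :: nat pair_pre_digraph. pair_graph \<Gamma> \<and> card (pverts \<Gamma>) = N \<longrightarrow>
           contains_subgraph \<Gamma> H1 \<or> contains_subgraph (complement_graph \<Gamma>) H2))"

lemma pair_graph_complement:
  assumes "pair_graph G" shows "pair_graph (complement_graph G)"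
proof -
  interpret pair_graph G by fact
  have "parcs (complement_graph G) \<subseteq> pverts G \<times> pverts G"
    by (auto simp: complement_graph_def)
  then have "finite (parcs (complement_graph G))"
    using pair_finite_verts by (meson finite_SigmaI finite_subset)
  then show ?thesis
    using pair_finite_verts
    by unfold_locales
      (auto simp: complement_graph_def symmetric_def intro!: symI dest: arcs_symmetric)
qed

lemma pair_graph_cycle:
  assumes "k \<ge> 3" shows "pair_graph (cycle_graph k)"
proof -
  have "parcs (cycle_graph k) \<subseteq> {..<k} \<times> {..<k}"
    by (auto simp: cycle_graph_def)
  then have fin: "finite (parcs (cycle_graph k))"
    by (meson finite_SigmaI finite_lessThan finite_subset)
  have "Suc i mod k \<noteq> i" if "i < k" for i
    using that assms by (cases "Suc i = k") auto
  with fin show ?thesis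
    by unfold_locales (auto simp: cycle_graph_def symmetric_def intro!: symI, metis+)
qed

lemma contains_subgraph_iff:
  assumes "pair_graph \<Gamma>" and "pair_graph H"
  shows "contains_subgraph \<Gamma> H \<longleftrightarrow>
    (\<exists>f. inj_on f (pverts H) \<and> f ` pverts H \<subseteq> pverts \<Gamma> \<and>
         (\<forall>(u, v) \<in> parcs H. (f u, f v) \<in> parcs \<Gamma>))" (is "_ \<longleftrightarrow> ?R")
proof
  interpret \<Gamma>: pair_graph \<Gamma> by fact
  interpret H: pair_graph H by fact
  show ?R if "contains_subgraph \<Gamma> H"
  proof -
    from that obtain K hom where K: "subgraph (with_proj K) (with_proj \<Gamma>)"
      and hom: "pre_digraph.digraph_isomorphism (with_proj H) hom"
      and eq: "with_proj K = app_iso hom (with_proj H)"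
      unfolding contains_subgraph_def digraph_iso_def by blast
    have pv: "pverts K = iso_verts hom ` pverts H" and pa: "parcs K = iso_arcs hom ` parcs H"
      and t: "fst = iso_tail hom" and h: "snd = iso_head hom"
      using eq unfolding with_proj_def app_iso_def by simp_all
    have "iso_arcs hom (u, v) = (iso_verts hom u, iso_verts hom v)"
      if "(u, v) \<in> parcs H" for u v
      using hom that unfolding pre_digraph.digraph_isomorphism_def
      by (fastforce simp flip: t h intro: prod_eqI)
    moreover have "pverts K \<subseteq> pverts \<Gamma>" "parcs K \<subseteq> parcs \<Gamma>"
      using K by (auto simp: subgraph_def)
    moreover have "inj_on (iso_verts hom) (pverts H)"
      using hom by (simp add: pre_digraph.digraph_isomorphism_def)
    ultimately show ?R
      using pv pa by (intro exI[of _ "iso_verts hom"]) force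
  qed
  show "contains_subgraph \<Gamma> H" if ?R
  proof -
    from that obtain f where f: "inj_on f (pverts H)" "f ` pverts H \<subseteq> pverts \<Gamma>"
      "\<forall>(u, v) \<in> parcs H. (f u, f v) \<in> parcs \<Gamma>"
      by blast
    define K where "K = \<lparr>pverts = f ` pverts H, parcs = map_prod f f ` parcs H\<rparr>"
    define hom where
      "hom = \<lparr>iso_verts = f, iso_arcs = map_prod f f, iso_head = snd, iso_tail = fst\<rparr>"
    have "wf_digraph (with_proj K)"
      by unfold_locales (auto simp: K_def dest: H.in_arcsD1 H.in_arcsD2)
    then have "subgraph (with_proj K) (with_proj \<Gamma>)"
      using f(2,3) \<Gamma>.wf_digraph by (auto simp: subgraph_def compatible_def K_def)
    moreover have "inj_on (map_prod f f) (parcs H)"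
      using f(1) unfolding inj_on_def by (auto; metis H.in_arcsD1 H.in_arcsD2)
    then have "pre_digraph.digraph_isomorphism (with_proj H) hom"
      using f(1) H.wf_digraph by (auto simp: pre_digraph.digraph_isomorphism_def hom_def)
    moreover have "with_proj K = app_iso hom (with_proj H)"
      by (simp add: with_proj_def app_iso_def K_def hom_def)
    ultimately show ?thesis
      unfolding contains_subgraph_def digraph_iso_def by blast
  qed
qed

end

theory Submission
  imports Defs
begin

text \<open>
  Two disjoint red cliques of order \<open>n - 1\<close> give the lower bound. For the upper bound, colour the
  edges of \<open>\<Gamma>\<close> red and those of its complement blue, and suppose that there is no blue \<open>C\<^sub>k\<close>, where
  \<open>k = 2 m + 1\<close>. Remove vertices of low red degree one after the other.

  If this stops within \<open>3 m\<close> steps, the remaining vertices have red degree at least \<open>n - 1\<close> among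
  themselves, so leaves can be added greedily, and it suffices to embed the part of \<open>G\<close> left after
  deleting leaves. A long path of vertices of degree two there can be shortened by one and lengthened
  again in the host, by inserting a new vertex, by a rotation, or by a detour. Without long paths of
  this kind that part is a short cycle, or it has \<open>O(m l)\<close> vertices, where \<open>n + l\<close> bounds the number
  of edges, and is embedded using that a blue neighbourhood contains no blue path on \<open>2 m\<close> vertices.

  Otherwise there are \<open>3 m\<close> vertices of high blue degree to the rest. Among them are \<open>m\<close> vertices
  whose blue neighbourhoods nearly coincide. Blue paths alternating between them and their common
  neighbours can be prescribed almost freely, so every further blue edge must respect this nearly
  bipartite structure, and one of its two sides contains \<open>n\<close> vertices and a red copy of \<open>G\<close>.
\<close>

section \<open>Sparse connected graphs\<close>

text \<open>The constants come from a few counts. Deletions may stop at \<open>3 m\<close> vertices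
  because three classes of fewer than \<open>m\<close> vertices cannot cover a set of that size;
  \<open>6 m\<close> is the total shortfall of two sets that each miss \<open>n\<close> by up to
  \<open>3 m\<close>. Four almost disjoint blue neighbourhoods would force
  \<open>2 n \<le> 27 m + 6 l - 17\<close>, which is excluded by \<open>n \<ge> 14 m + 3\<close>,
  that is, \<open>n \<ge> 7 k - 4\<close>. A path counts as long from \<open>5 m\<close> vertices
  on: if it cannot be lengthened, a spare vertex has at most \<open>2 m - 1\<close> red neighbours
  among \<open>5 m - 2\<close> path vertices, so two spare vertices share at least
  \<open>5 m - 2 - 2 (2 m - 1) = m\<close> blue neighbours, just enough to close a blue cycle. The
  factor \<open>36 k^2\<close> pays for a greedy embedding in which every arc is charged
  \<open>2 m - 1\<close> host vertices.\<close>

definition sgraph :: "'a set \<Rightarrow> ('a \<times> 'a) set \<Rightarrow> bool" where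
  "sgraph A E \<longleftrightarrow> finite A \<and> E \<subseteq> A \<times> A \<and> sym E \<and> irrefl E"

text \<open>Connectivity by cuts: this form yields the next vertex when a set is grown, and it
  survives the deletion of a vertex by assigning that vertex to one side of the cut.\<close>

definition connected_on :: "'a set \<Rightarrow> ('a \<times> 'a) set \<Rightarrow> bool" where
  "connected_on A E \<longleftrightarrow>
     (\<forall>S\<subseteq>A. S \<noteq> {} \<longrightarrow> S \<noteq> A \<longrightarrow> (\<exists>u\<in>S. \<exists>v\<in>A - S. (u, v) \<in> E))"

definition indep :: "('a \<times> 'a) set \<Rightarrow> 'a set \<Rightarrow> bool" where
  "indep E I \<longleftrightarrow> (\<forall>u\<in>I. \<forall>v\<in>I. (u, v) \<notin> E)"

lemma indep_subset: "indep E I \<Longrightarrow> J \<subseteq> I \<Longrightarrow> indep E J"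
  by (auto simp: indep_def)

lemma sgraphD:
  assumes "sgraph A E"
  shows "finite A" "E \<subseteq> A \<times> A" "\<And>u v. (u, v) \<in> E \<Longrightarrow> (v, u) \<in> E" "\<And>u. (u, u) \<notin> E"
    "finite E" "\<And>u v. (u, v) \<in> E \<Longrightarrow> u \<in> A" "\<And>u v. (u, v) \<in> E \<Longrightarrow> v \<in> A"
    "finite (E `` S)"
proof -
  show "finite A" "E \<subseteq> A \<times> A" "\<And>u v. (u, v) \<in> E \<Longrightarrow> (v, u) \<in> E" "\<And>u. (u, u) \<notin> E"
    using assms by (auto simp: sgraph_def sym_def irrefl_def)
  then show "finite E" by (meson finite_SigmaI finite_subset)
  show "u \<in> A" "v \<in> A" if "(u, v) \<in> E" for u v
    using \<open>E \<subseteq> A \<times> A\<close> that by auto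
  show "finite (E `` S)"
    using \<open>finite A\<close> \<open>E \<subseteq> A \<times> A\<close> by (auto intro: finite_subset)
qed

lemma card_arcs:
  assumes "sgraph A E" shows "card E = (\<Sum>v\<in>A. card (E `` {v}))"
proof -
  note g = sgraphD[OF assms]
  have "E = Sigma A (\<lambda>v. E `` {v})" using g by auto
  then show ?thesis using g by (metis card_SigmaI)
qed

lemma card_restrict_insert:
  assumes "sgraph A E" "S \<subseteq> A" "v \<in> A" "v \<notin> S"
  shows "card (E \<inter> insert v S \<times> insert v S) = card (E \<inter> S \<times> S) + 2 * card (E `` {v} \<inter> S)"
proof -
  note g = sgraphD[OF assms(1)]
  let ?N = "E `` {v} \<inter> S"
  have eq: "E \<inter> insert v S \<times> insert v S = (E \<inter> S \<times> S) \<union> ((\<lambda>u. (v, u)) ` ?N \<union> (\<lambda>u. (u, v)) ` ?N)"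
    using g(3,4) by auto
  have fin: "finite ?N" "finite (E \<inter> S \<times> S)" using g by auto
  have c1: "card ((\<lambda>u. (v, u)) ` ?N) = card ?N" "card ((\<lambda>u. (u, v)) ` ?N) = card ?N"
    by (auto intro!: card_image inj_onI)
  have "card ((\<lambda>u. (v, u)) ` ?N \<union> (\<lambda>u. (u, v)) ` ?N) = 2 * card ?N"
    using c1 fin assms(4) by (subst card_Un_disjoint) auto
  then show ?thesis
    unfolding eq using fin assms(4) by (subst card_Un_disjoint) auto
qed

lemma sgraph_restrict:
  assumes "sgraph A E" "S \<subseteq> A" shows "sgraph S (E \<inter> S \<times> S)"
  using assms by (auto simp: sgraph_def sym_def irrefl_def intro: finite_subset)

text \<open>
  Grow a connected set one vertex at a time; a new vertex either has one neighbour in the set, and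
  takes the other colour, or closes a cycle and goes to \<open>T\<close>.
\<close>

lemma near_bipartition:
  assumes g: "sgraph A E" and conn: "connected_on A E" and "A \<noteq> {}"
  obtains T I J where "A = T \<union> I \<union> J" "T \<inter> I = {}" "T \<inter> J = {}" "I \<inter> J = {}"
    "indep E I" "indep E J" "2 * (card T + card A) \<le> card E + 2"
proof -
  note g' = sgraphD[OF g]
  \<comment> \<open>The arc count pays for \<open>T\<close>: a vertex put there adds four on the
    left and at least four arcs, any other vertex adds two on the left and two arcs.\<close>
  define P where "P S T I J \<longleftrightarrow> S = T \<union> I \<union> J \<and> T \<inter> I = {} \<and> T \<inter> J = {} \<and> I \<inter> J = {} \<and>
    indep E I \<and> indep E J \<and> 2 * (card T + card S) \<le> card (E \<inter> S \<times> S) + 2" for S T I J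
  have "j \<ge> 1 \<Longrightarrow> j \<le> card A \<Longrightarrow> \<exists>S T I J. S \<subseteq> A \<and> card S = j \<and> P S T I J" for j
  proof (induction j rule: nat_induct_at_least)
    case base
    from \<open>A \<noteq> {}\<close> obtain a where "a \<in> A" by auto
    moreover have "P {a} {} {a} {}"
      using g'(4) by (auto simp: P_def indep_def)
    ultimately show ?case by (intro exI[of _ "{a}"] exI conjI) auto
  next
    case (Suc j)
    then obtain S T I J where S: "S \<subseteq> A" "card S = j" and P: "P S T I J"
      by auto
    have "S \<noteq> A" "S \<noteq> {}" using S(2) Suc by auto
    with conn S(1) obtain u v where uv: "u \<in> S" "v \<in> A" "v \<notin> S" "(u, v) \<in> E"
      unfolding connected_on_def by blast
    let ?S = "insert v S"
    have finS: "finite S" using S(1) g'(1) finite_subset by auto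
    have cS: "card ?S = Suc j" "?S \<subseteq> A" using uv S finS by auto
    have cE: "card (E \<inter> ?S \<times> ?S) = card (E \<inter> S \<times> S) + 2 * card (E `` {v} \<inter> S)"
      using card_restrict_insert[OF g S(1) uv(2,3)] .
    have finN: "finite (E `` {v} \<inter> S)" using finS by auto
    have uN: "u \<in> E `` {v} \<inter> S" using uv g'(3) by auto
    have Seq: "S = T \<union> I \<union> J" and disj: "T \<inter> I = {}" "T \<inter> J = {}" "I \<inter> J = {}"
      and ind: "indep E I" "indep E J" and le: "2 * (card T + card S) \<le> card (Restr E S) + 2"
      using P unfolding P_def by blast+
    have vT: "v \<notin> T" "v \<notin> I" "v \<notin> J" using Seq uv(3) by blast+
    show ?case
    proof (cases "card (E `` {v} \<inter> S) \<ge> 2")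
      case True
      have "finite T" using finS Seq by auto
      then have "card (insert v T) = Suc (card T)"
        using vT by auto
      then have "2 * (card (insert v T) + card ?S) \<le> card (Restr E ?S) + 2"
        unfolding cS(1) cE using le True S(2) by simp
      moreover have "?S = insert v T \<union> I \<union> J" using Seq by blast
      moreover have "insert v T \<inter> I = {}" "insert v T \<inter> J = {}" using disj vT by blast+
      ultimately have "P ?S (insert v T) I J"
        unfolding P_def using disj ind by blast
      then show ?thesis using cS by blast
    next
      case False
      have N: "x = u" if "(v, x) \<in> E \<or> (x, v) \<in> E" "x \<in> S" for x
      proof (rule ccontr)
        assume "x \<noteq> u"
        then have "card {x, u} \<le> card (E `` {v} \<inter> S)"
          using that g'(3) uN finN by (intro card_mono) auto
        with \<open>x \<noteq> u\<close> False show False by simp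
      qed
      have "card (E `` {v} \<inter> S) \<ge> 1"
        using uN finN by (auto simp: Suc_le_eq card_gt_0_iff)
      have 1: "2 * (card T + card ?S) \<le> card (E \<inter> ?S \<times> ?S) + 2"
      proof -
        show ?thesis using le unfolding cS(1) cE S(2) using \<open>card (E `` {v} \<inter> S) \<ge> 1\<close> by simp
      qed
      show ?thesis
      proof (cases "u \<in> I")
        case True
        have "u \<notin> J" using True disj by blast
        moreover have "J \<subseteq> S" "indep E J" using Seq ind by blast+
        ultimately have "indep E (insert v J)"
          using N g'(4) unfolding indep_def by blast
        moreover have "?S = T \<union> I \<union> insert v J" using Seq by blast
        moreover have "T \<inter> insert v J = {}" "I \<inter> insert v J = {}" using disj vT by blast+
        ultimately have "P ?S T I (insert v J)"
          unfolding P_def using disj ind 1 by blast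
        then show ?thesis using cS by blast
      next
        case False
        moreover have "I \<subseteq> S" "indep E I" using Seq ind by blast+
        ultimately have "indep E (insert v I)"
          using N g'(4) unfolding indep_def by blast
        moreover have "?S = T \<union> insert v I \<union> J" using Seq by blast
        moreover have "T \<inter> insert v I = {}" "insert v I \<inter> J = {}" using disj vT by blast+
        ultimately have "P ?S T (insert v I) J"
          unfolding P_def using disj ind 1 by blast
        then show ?thesis using cS by blast
      qed
    qed
  qed
  from this[of "card A"] obtain S T I J where S: "S \<subseteq> A" "card S = card A" and P: "P S T I J"
    using \<open>A \<noteq> {}\<close> g'(1) by (auto simp: Suc_le_eq card_gt_0_iff)
  then have "S = A" using g'(1) card_subset_eq by blast
  then have "P A T I J" using P by simp
  moreover have "Restr E A = E" using g' by auto
  ultimately show thesis using that[of T I J] unfolding P_def by metis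
qed


section \<open>Degree-two vertices and leafless graphs\<close>

definition twos :: "'a set \<Rightarrow> ('a \<times> 'a) set \<Rightarrow> 'a set" where
  "twos A E = {v\<in>A. card (E `` {v}) = 2}"

lemma closed_is_all:
  assumes "connected_on A E" "S \<subseteq> A" "S \<noteq> {}" "\<And>u v. u \<in> S \<Longrightarrow> (u, v) \<in> E \<Longrightarrow> v \<in> S"
  shows "S = A"
  using assms unfolding connected_on_def by blast

lemma two_nbrs:
  assumes "card (N) = 2" "a \<in> N" "b \<in> N" "a \<noteq> b" shows "N = {a, b}"
  using assms by (auto simp: card_2_iff)

text \<open>A longest path in the degree-two vertices absorbs its whole component there.\<close>

lemma twos_class_path:
  assumes g: "sgraph A E" and v: "v \<in> twos A E"
    and big: "card ((Restr E (twos A E))\<^sup>* `` {v}) > q"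
  obtains vs where "distinct vs" "length vs = Suc q" "set vs \<subseteq> twos A E"
    "successively (\<lambda>x y. (x, y) \<in> E) vs"
proof -
  note g' = sgraphD[OF g]
  let ?D = "twos A E" and ?adj = "\<lambda>x y. (x, y) \<in> E"
  have finD: "finite ?D" using g'(1) by (auto simp: twos_def)
  define P where "P vs \<longleftrightarrow> v \<in> set vs \<and> distinct vs \<and> set vs \<subseteq> ?D \<and> successively ?adj vs" for vs
  have "P [v]" using v by (auto simp: P_def)
  moreover have "length vs < Suc (card ?D)" if "P vs" for vs
    using that card_mono[OF finD, of "set vs"] distinct_card[of vs] by (auto simp: P_def)
  ultimately obtain vs where P: "P vs" and max: "\<And>ws. P ws \<Longrightarrow> length ws \<le> length vs"
    using ex_has_greatest_nat[of P "[v]" length "Suc (card ?D)"] by (metis less_imp_le)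
  have "vs \<noteq> []" using P by (auto simp: P_def)
  \<comment> \<open>A further neighbour of an end would prolong the path, and an inner vertex, being
    of degree two, already has both neighbours on it.\<close>
  have closed: "y \<in> set vs" if "x \<in> set vs" "(x, y) \<in> E" "y \<in> ?D" for x y
  proof (rule ccontr)
    assume y: "y \<notin> set vs"
    from that obtain i where i: "i < length vs" "vs ! i = x" by (auto simp: in_set_conv_nth)
    have adj: "(vs ! j, vs ! Suc j) \<in> E" if "Suc j < length vs" for j
      using P that by (auto simp: P_def successively_conv_nth)
    consider "i = 0" | "Suc i = length vs" | "i > 0" "Suc i < length vs"
      using i by linarith
    then show False
    proof cases
      case 1
      have "P (y # vs)"
        using P y that i 1 g'(3) \<open>vs \<noteq> []\<close> by (auto simp: P_def successively_Cons hd_conv_nth)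
      from max[OF this] show False by simp
    next
      case 2
      then have "last vs = x" using i \<open>vs \<noteq> []\<close> by (metis diff_Suc_1 last_conv_nth)
      then have "P (vs @ [y])"
        using P y that \<open>vs \<noteq> []\<close> by (auto simp: P_def successively_append_iff)
      from max[OF this] show False by simp
    next
      case 3
      have ne: "vs ! (i - 1) \<noteq> vs ! Suc i" using 3 P by (auto simp: P_def nth_eq_iff_index_eq)
      have "vs ! (i - 1) \<in> E `` {x}" "vs ! Suc i \<in> E `` {x}"
        using adj[of "i - 1"] adj[of i] 3 i g'(3) by auto
      moreover have "x \<in> ?D" using P that(1) unfolding P_def by blast
      then have "card (E `` {x}) = 2" by (simp add: twos_def)
      ultimately have "E `` {x} = {vs ! (i - 1), vs ! Suc i}"
        using ne two_nbrs by metis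
      then have "y \<in> {vs ! (i - 1), vs ! Suc i}" using that by auto
      then show False using y 3 i by auto
    qed
  qed
  have "(Restr E ?D)\<^sup>* `` {v} \<subseteq> set vs"
  proof
    fix w assume "w \<in> (Restr E ?D)\<^sup>* `` {v}"
    then have "(v, w) \<in> (Restr E ?D)\<^sup>*" by auto
    then show "w \<in> set vs"
      by induction (use P closed in \<open>auto simp: P_def\<close>)
  qed
  then have "q < length vs" using big card_mono[of "set vs"] card_length[of vs]
    by (metis List.finite_set le_trans not_less)
  moreover have "successively ?adj (take (Suc q) vs)"
  proof -
    have "successively ?adj (take (Suc q) vs @ drop (Suc q) vs)" using P by (simp add: P_def)
    then show ?thesis unfolding successively_append_iff by blast
  qed
  moreover have "set (take (Suc q) vs) \<subseteq> ?D" "distinct (take (Suc q) vs)"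
    using P set_take_subset[of "Suc q" vs] by (auto simp: P_def)
  ultimately show thesis
    using that[of "take (Suc q) vs"] by simp
qed

lemma degree_pos:
  assumes g: "sgraph A E" and conn: "connected_on A E" and "v \<in> A" "card A \<ge> 2"
  shows "card (E `` {v}) \<ge> 1"
proof -
  note g' = sgraphD[OF g]
  have "A \<noteq> {v}" using assms(4) by auto
  then obtain u where "(v, u) \<in> E"
    using conn \<open>v \<in> A\<close> unfolding connected_on_def by blast
  then have "E `` {v} \<noteq> {}" by auto
  then show ?thesis using g'(8) by (simp add: Suc_le_eq card_gt_0_iff)
qed

text \<open>
  Each class of degree-two vertices is entered from a vertex of degree at least three, and the
  arcs leaving such vertices number at most \<open>6 l\<close>.
\<close>

lemma card_leafless:
  assumes g: "sgraph A E" and conn: "connected_on A E"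
    and deg: "\<And>v. v \<in> A \<Longrightarrow> card (E `` {v}) \<ge> 2"
    and E: "card E \<le> 2 * card A + 2 * l"
    and cls: "\<And>v. v \<in> twos A E \<Longrightarrow> card ((Restr E (twos A E))\<^sup>* `` {v}) \<le> q"
    and ne: "twos A E \<noteq> A"
  shows "card A \<le> 2 * l + 6 * l * q"
proof -
  note g' = sgraphD[OF g]
  let ?D = "twos A E" and ?adj = "\<lambda>x y. (x, y) \<in> E"
  let ?cls = "\<lambda>u. (Restr E ?D)\<^sup>* `` {u}"
  define Z where "Z = A - ?D"
  have DA: "?D \<subseteq> A" and fin: "finite ?D" "finite Z" using g'(1) by (auto simp: twos_def Z_def)
  have Z3: "card (E `` {v}) \<ge> 3" if "v \<in> Z" for v
    using deg[of v] that by (auto simp: Z_def twos_def)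
  have cA: "card A = card ?D + card Z"
    using DA g'(1) card_Un_disjoint[of ?D Z] fin by (auto simp: Z_def Un_absorb1)
  have "card E = (\<Sum>v\<in>?D. card (E `` {v})) + (\<Sum>v\<in>Z. card (E `` {v}))"
    unfolding card_arcs[OF g] Z_def using DA g'(1) by (metis add.commute sum.subset_diff)
  also have "(\<Sum>v\<in>?D. card (E `` {v})) = 2 * card ?D" by (simp add: twos_def)
  finally have s: "(\<Sum>v\<in>Z. card (E `` {v})) \<le> 2 * card Z + 2 * l"
    using E cA by simp
  moreover have "3 * card Z \<le> (\<Sum>v\<in>Z. card (E `` {v}))"
    using sum_bounded_below[of Z 3 "\<lambda>v. card (E `` {v})"] Z3 by (simp add: mult.commute)
  \<comment> \<open>The degrees in \<open>Z\<close> sum to at least \<open>3 * card Z\<close> and at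
    most \<open>2 * card Z + 2 * l\<close>.\<close>
  ultimately have cZ: "card Z \<le> 2 * l" and dZ: "(\<Sum>v\<in>Z. card (E `` {v})) \<le> 6 * l" by auto
  define X where "X = (SIGMA b:Z. E `` {b} \<inter> ?D)"
  have finX: "finite X" using fin by (auto simp: X_def)
  have "card X = (\<Sum>b\<in>Z. card (E `` {b} \<inter> ?D))"
    unfolding X_def using fin by (simp add: card_SigmaI)
  also have "\<dots> \<le> (\<Sum>b\<in>Z. card (E `` {b}))"
    by (intro sum_mono card_mono g'(8)) auto
  finally have cX: "card X \<le> 6 * l" using dZ by simp
  have symr: "sym ((Restr E ?D)\<^sup>*)"
    using g'(3) by (intro sym_rtrancl symI) auto
  have "?D \<subseteq> (\<Union>p\<in>X. ?cls (snd p))"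
  proof
    fix v assume v: "v \<in> ?D"
    let ?C = "?cls v"
    have CD: "?C \<subseteq> ?D"
    proof
      fix w assume "w \<in> ?C"
      then have "(v, w) \<in> (Restr E ?D)\<^sup>*" by auto
      then show "w \<in> ?D" by induction (use v in auto)
    qed
    then have "?C \<noteq> A" "?C \<subseteq> A" using ne DA by auto
    then obtain u b where ub: "u \<in> ?C" "(u, b) \<in> E" "b \<notin> ?C"
      using closed_is_all[OF conn, of ?C] by blast
    have "b \<notin> ?D"
    proof
      assume "b \<in> ?D"
      then have "(u, b) \<in> Restr E ?D" using ub CD by auto
      then show False using ub by (auto dest: rtrancl_into_rtrancl)
    qed
    then have "b \<in> Z" using ub g' by (auto simp: Z_def)
    then have "(b, u) \<in> X" using ub CD g'(3) by (auto simp: X_def)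
    moreover have "v \<in> ?cls u" using ub symr by (auto dest: symD)
    ultimately show "v \<in> (\<Union>p\<in>X. ?cls (snd p))" by (intro UN_I[of "(b, u)"]) auto
  qed
  moreover have "card (\<Union>p\<in>X. ?cls (snd p)) \<le> (\<Sum>p\<in>X. card (?cls (snd p)))"
    by (rule card_UN_le[OF finX])
  moreover have "(\<Sum>p\<in>X. card (?cls (snd p))) \<le> card X * q"
    using sum_bounded_above[of X "\<lambda>p. card (?cls (snd p))" q] cls by (auto simp: X_def)
  moreover have "finite (\<Union>p\<in>X. ?cls (snd p))"
  proof -
    have "?cls u \<subseteq> insert u ?D" for u
    proof
      fix w assume "w \<in> ?cls u"
      then have "(u, w) \<in> (Restr E ?D)\<^sup>*" by auto
      then show "w \<in> insert u ?D" by induction auto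
    qed
    then show ?thesis using finX fin by (meson finite_UN_I finite_insert finite_subset)
  qed
  ultimately have "card ?D \<le> card X * q" by (meson card_mono le_trans)
  also have "\<dots> \<le> 6 * l * q" using cX by simp
  finally show ?thesis using cA cZ by simp
qed

section \<open>Two reductions: deleting a leaf, suppressing a degree-two vertex\<close>

text \<open>One vertex and two arcs disappear, so \<open>card E - 2 * card A\<close> is invariant;
  this carries the edge bound through the later induction. A cut of the smaller graph extends to
  \<open>A\<close> with \<open>v\<close> on the side of \<open>u\<close>, and then its crossing arc
  avoids \<open>v\<close>.\<close>

lemma remove_leaf:
  assumes g: "sgraph A E" and conn: "connected_on A E" and v: "v \<in> A" and N: "E `` {v} = {u}"
  defines "A' \<equiv> A - {v}"
  shows "sgraph A' (Restr E A')" "connected_on A' (Restr E A')" "card E = card (Restr E A') + 2"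
    "u \<in> A'" "card A = Suc (card A')"
proof -
  note g' = sgraphD[OF g]
  have vu: "(v, u) \<in> E" using N by auto
  then show u: "u \<in> A'" using g' by (auto simp: A'_def)
  show "sgraph A' (Restr E A')" by (rule sgraph_restrict[OF g]) (auto simp: A'_def)
  have ins: "insert v A' = A" using v by (auto simp: A'_def)
  have RA: "Restr E A = E" using g' by auto
  have "E `` {v} \<inter> A' = {u}" using N u by auto
  moreover have "card (Restr E (insert v A')) = card (Restr E A') + 2 * card (E `` {v} \<inter> A')"
    using v by (intro card_restrict_insert[OF g]) (auto simp: A'_def)
  ultimately show "card E = card (Restr E A') + 2"
    unfolding ins RA by simp
  show "card A = Suc (card A')" using v g'(1) unfolding A'_def by (rule card.remove[OF _ _, rotated])
  show "connected_on A' (Restr E A')"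
    unfolding connected_on_def
  proof (intro allI impI)
    fix S assume S: "S \<subseteq> A'" "S \<noteq> {}" "S \<noteq> A'"
    define S' where "S' = (if u \<in> S then insert v S else S)"
    have "S' \<subseteq> A" "S' \<noteq> {}" "S' \<noteq> A" using S v u by (auto simp: S'_def A'_def)
    then obtain x y where xy: "x \<in> S'" "y \<in> A - S'" "(x, y) \<in> E"
      using conn unfolding connected_on_def by blast
    have "x \<noteq> v" using xy N u S by (auto simp: S'_def A'_def split: if_splits)
    moreover have "y \<noteq> v"
    proof
      assume "y = v"
      then have "x = u" using xy(3) N g'(3) by auto
      then show False using xy \<open>y = v\<close> u v by (auto simp: S'_def A'_def split: if_splits)
    qed
    ultimately have "x \<in> S" "y \<in> A' - S"
      using xy(1,2) by (auto simp: S'_def A'_def split: if_splits)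
    moreover from this have "(x, y) \<in> Restr E A'" using xy(3) S(1) by auto
    ultimately show "\<exists>x\<in>S. \<exists>y\<in>A' - S. (x, y) \<in> Restr E A'" by blast
  qed
qed

text \<open>Again one vertex and one edge are lost, as the two edges at \<open>v\<close> give way to
  the edge \<open>u w\<close>; \<open>(u, w) \<notin> E\<close> keeps this count exact. The new edge
  crosses every cut that separates \<open>u\<close> from \<open>w\<close>; for the other cuts
  \<open>v\<close> joins their common side.\<close>

lemma suppress:
  assumes g: "sgraph A E" and conn: "connected_on A E" and v: "v \<in> A" and N: "E `` {v} = {u, w}"
    and uw: "u \<noteq> w" "(u, w) \<notin> E"
  defines "A' \<equiv> A - {v}"
  defines "E' \<equiv> Restr E A' \<union> {(u, w), (w, u)}"
  shows "sgraph A' E'" "connected_on A' E'" "card E = card E' + 2" "card A = Suc (card A')"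
proof -
  note g' = sgraphD[OF g]
  have vu: "(v, u) \<in> E" "(v, w) \<in> E" using N by auto
  then have u: "u \<in> A'" "w \<in> A'" using g' by (auto simp: A'_def)
  show "sgraph A' E'"
    unfolding sgraph_def
  proof (intro conjI)
    show "finite A'" using g'(1) by (simp add: A'_def)
    show "E' \<subseteq> A' \<times> A'" using u by (auto simp: E'_def)
    show "sym E'" using g'(3) by (auto simp: E'_def intro!: symI)
    show "irrefl E'" using g'(4) uw by (auto simp: E'_def irrefl_def)
  qed
  have ins: "insert v A' = A" using v by (auto simp: A'_def)
  have RA: "Restr E A = E" using g' by auto
  have "E `` {v} \<inter> A' = {u, w}" using N u by auto
  moreover have "card (Restr E (insert v A')) = card (Restr E A') + 2 * card (E `` {v} \<inter> A')"
    using v by (intro card_restrict_insert[OF g]) (auto simp: A'_def)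
  ultimately have "card E = card (Restr E A') + 4"
    unfolding ins RA using uw by simp
  moreover have "card E' = card (Restr E A') + 2"
  proof -
    have "(w, u) \<notin> E" using uw g'(3) by auto
    then show ?thesis unfolding E'_def using uw g'(5) by (subst card_Un_disjoint) auto
  qed
  ultimately show "card E = card E' + 2" by simp
  show "card A = Suc (card A')" using v g'(1) unfolding A'_def by (rule card.remove[OF _ _, rotated])
  show "connected_on A' E'"
    unfolding connected_on_def
  proof (intro allI impI)
    fix S assume S: "S \<subseteq> A'" "S \<noteq> {}" "S \<noteq> A'"
    show "\<exists>x\<in>S. \<exists>y\<in>A' - S. (x, y) \<in> E'"
    proof (cases "(u \<in> S) = (w \<in> S)")
      case False
      then show ?thesis using u by (auto simp: E'_def)
    next
      case True
      define S' where "S' = (if u \<in> S then insert v S else S)"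
      have "S' \<subseteq> A" "S' \<noteq> {}" "S' \<noteq> A" using S v u by (auto simp: S'_def A'_def)
      then obtain x y where xy: "x \<in> S'" "y \<in> A - S'" "(x, y) \<in> E"
        using conn unfolding connected_on_def by blast
      have "x \<noteq> v" using xy N u S True by (auto simp: S'_def A'_def split: if_splits)
      moreover have "y \<noteq> v"
      proof
        assume "y = v"
        then have "x = u \<or> x = w" using xy(3) N g'(3) by auto
        then show False using xy \<open>y = v\<close> u v True by (auto simp: S'_def A'_def split: if_splits)
      qed
      ultimately have "x \<in> S" "y \<in> A' - S"
        using xy(1,2) by (auto simp: S'_def A'_def split: if_splits)
      moreover from this have "(x, y) \<in> E'" using xy(3) S(1) by (auto simp: E'_def)
      ultimately show ?thesis by blast
    qed
  qed
qed

section \<open>Graphs without a given odd cycle\<close>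

text \<open>The anchors of a blue path that alternates with vertices of \<open>W\<close>:
  consecutive anchors have so many common neighbours that the connecting vertices can be chosen
  later, away from any few forbidden ones.\<close>

definition chain :: "('b \<Rightarrow> 'b \<Rightarrow> bool) \<Rightarrow> 'b set \<Rightarrow> nat \<Rightarrow> 'b list \<Rightarrow> bool" where
  "chain B W N ls \<longleftrightarrow> distinct ls \<and> successively (\<lambda>x y. N \<le> card {w\<in>W. B x w \<and> B w y}) ls"

text \<open>Connecting vertices are picked greedily, and each joins the forbidden set. At the last
  of the \<open>length ls - 1\<close> gaps \<open>card X + length ls - 2\<close> vertices are
  forbidden, which the bound keeps below \<open>N\<close>.\<close>

lemma alternating_path:
  assumes "chain B W N ls" "ls \<noteq> []" "finite W" "finite X" "W \<inter> set ls = {}" "card X + length ls \<le> N + 1"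
  obtains p where "distinct p" "successively B p" "p \<noteq> []" "hd p = hd ls" "last p = last ls"
    "length p = 2 * length ls - 1" "set p \<subseteq> set ls \<union> (W - X)"
proof -
  have "\<exists>p. distinct p \<and> successively B p \<and> p \<noteq> [] \<and> hd p = hd ls \<and> last p = last ls \<and>
    length p = 2 * length ls - 1 \<and> set p \<subseteq> set ls \<union> (W - X)"
    using assms
  proof (induction ls arbitrary: X)
    case (Cons l ls)
    show ?case
    proof (cases ls)
      case Nil
      then show ?thesis by (intro exI[of _ "[l]"]) auto
    next
      case (Cons l' rest)
      let ?C = "{w\<in>W. B l w \<and> B w l'}"
      have ch: "chain B W N ls" and N: "N \<le> card ?C"
        using Cons.prems(1) Cons by (auto simp: chain_def)
      have "card X < card ?C" using N Cons Cons.prems(6) by simp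
      then have "\<not> ?C \<subseteq> X" using card_mono[OF \<open>finite X\<close>, of ?C] by linarith
      then obtain w where w: "w \<in> ?C" "w \<notin> X" by blast
      have cX: "card (insert w X) = Suc (card X)" using w \<open>finite X\<close> by simp
      obtain p where p: "distinct p" "successively B p" "p \<noteq> []" "hd p = hd ls" "last p = last ls"
        "length p = 2 * length ls - 1" "set p \<subseteq> set ls \<union> (W - insert w X)"
        using Cons.IH[OF ch _ \<open>finite W\<close>, of "insert w X"] Cons Cons.prems cX by auto
      have "w \<in> W" "w \<notin> set p" "l \<notin> set p" "l \<noteq> w"
        using p(7) w Cons.prems(1,5) by (auto simp: chain_def)
      moreover have "hd p = l'" using p(4) Cons by simp
      ultimately show ?thesis
        using p w Cons
        by (intro exI[of _ "l # w # p"]) (auto simp: successively_Cons)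
    qed
  qed simp
  then show thesis using that by blast
qed

lemma chain_const:
  assumes "distinct ls" "\<And>x y. x \<in> set ls \<Longrightarrow> y \<in> set ls \<Longrightarrow> x \<noteq> y \<Longrightarrow> N \<le> card {w\<in>W. B x w \<and> B w y}"
  shows "chain B W N ls"
  unfolding chain_def
proof
  show "successively (\<lambda>x y. N \<le> card {w\<in>W. B x w \<and> B w y}) ls"
    using assms(1) by (auto simp: successively_conv_nth nth_eq_iff_index_eq intro!: assms(2))
qed (rule assms(1))

lemma list_with_ends:
  assumes "finite L" "x \<in> L" "y \<in> L" "x \<noteq> y" "2 \<le> j" "j \<le> card L"
  obtains ls where "distinct ls" "set ls \<subseteq> L" "length ls = j" "hd ls = x" "last ls = y"
proof -
  have "j - 2 \<le> card (L - {x, y})" using assms by (simp add: card_Diff_subset)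
  then obtain S where S: "S \<subseteq> L - {x, y}" "card S = j - 2" by (meson obtain_subset_with_card_n)
  then have "finite S" using assms(1) finite_subset by fastforce
  then obtain ms where ms: "set ms = S" "distinct ms" using finite_distinct_list by blast
  then have "length ms = j - 2" using S distinct_card by fastforce
  with ms S assms show thesis by (intro that[of "x # ms @ [y]"]) auto
qed

locale odd_cycle_free =
  fixes V :: "'b set" and B :: "'b \<Rightarrow> 'b \<Rightarrow> bool" and m :: nat
  assumes finV: "finite V" and symB: "B x y \<Longrightarrow> B y x" and irrB: "\<not> B x x" and m1: "m \<ge> 1"
    and nocyc: "set cs \<subseteq> V \<Longrightarrow> distinct cs \<Longrightarrow> length cs = 2 * m + 1 \<Longrightarrow> successively B cs \<Longrightarrow>
      B (last cs) (hd cs) \<Longrightarrow> False"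
begin

lemma finite_sub: "S \<subseteq> V \<Longrightarrow> finite S"
  using finV finite_subset by blast

text \<open>With \<open>m\<close> connecting vertices the \<open>m + 1\<close> anchors form a path
  on \<open>2 m + 1\<close> vertices, which a blue edge between its ends would close.\<close>

lemma chain_ends_nonadjacent:
  assumes "chain B W N ls" "length ls = m + 1" "set ls \<subseteq> V" "W \<subseteq> V" "W \<inter> set ls = {}" "m \<le> N"
  shows "\<not> B (last ls) (hd ls)"
proof
  assume "B (last ls) (hd ls)"
  obtain p where p: "distinct p" "successively B p" "p \<noteq> []" "hd p = hd ls" "last p = last ls"
    "length p = 2 * length ls - 1" "set p \<subseteq> set ls \<union> (W - {})"
    by (rule alternating_path[OF assms(1), of "{}"])
      (use assms finite_sub[OF assms(4)] in auto)
  show False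
    by (rule nocyc[of p]) (use p assms \<open>B (last ls) (hd ls)\<close> in auto)
qed

text \<open>The \<open>m\<close> anchors give a path on \<open>2 m - 1\<close> vertices, and
  \<open>w\<close>, \<open>w'\<close> complete the cycle. Connecting vertices must avoid these two,
  hence the bound \<open>m + 1\<close>.\<close>

lemma chain_nbrs_nonadjacent:
  assumes "chain B W N ls" "length ls = m" "set ls \<subseteq> V" "W \<subseteq> V" "W \<inter> set ls = {}" "m + 1 \<le> N"
    and "w \<in> V - set ls" "w' \<in> V - set ls" "B (hd ls) w" "B (last ls) w'"
  shows "\<not> B w w'"
proof
  assume ww: "B w w'"
  then have ne: "w \<noteq> w'" using irrB by auto
  have "ls \<noteq> []" using assms(2) m1 by auto
  obtain p where p: "distinct p" "successively B p" "p \<noteq> []" "hd p = hd ls" "last p = last ls"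
    "length p = 2 * length ls - 1" "set p \<subseteq> set ls \<union> (W - {w, w'})"
    by (rule alternating_path[OF assms(1), of "{w, w'}"])
      (use assms finite_sub[OF assms(4)] ne \<open>ls \<noteq> []\<close> in auto)
  show False
  proof (rule nocyc[of "w # p @ [w']"])
    show "set (w # p @ [w']) \<subseteq> V" using p assms by auto
    show "distinct (w # p @ [w'])" using p assms ne by auto
    show "length (w # p @ [w']) = 2 * m + 1" using p assms m1 by auto
    show "successively B (w # p @ [w'])"
      using p assms symB by (auto simp: successively_Cons successively_append_iff)
    show "B (last (w # p @ [w'])) (hd (w # p @ [w']))" using ww symB by simp
  qed
qed

text \<open>Here \<open>m - 1\<close> anchors give \<open>2 m - 3\<close> vertices, and the path
  \<open>w, z, z', w'\<close> closes the cycle. Avoiding its four vertices costs the bound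
  \<open>m + 2\<close>.\<close>

lemma chain_nbrs_no_path3:
  assumes "chain B W N ls" "length ls = m - 1" "m \<ge> 2" "set ls \<subseteq> V" "W \<subseteq> V" "W \<inter> set ls = {}" "m + 2 \<le> N"
    and "w \<in> V - set ls" "w' \<in> V - set ls" "B (hd ls) w" "B (last ls) w'"
    and "z \<in> V - set ls" "z' \<in> V - set ls" "B w z" "B z z'" "B z' w'"
    and ne: "w \<noteq> w'" "w \<noteq> z'" "z \<noteq> w'"
  shows False
proof -
  have ne': "w \<noteq> z" "z \<noteq> z'" "z' \<noteq> w'" using assms irrB by auto
  have "ls \<noteq> []" using assms(2,3) by auto
  have "card {w, w', z, z'} = 4" using ne ne' by auto
  then have "card {w, w', z, z'} + length ls \<le> N + 1" using assms(2,3,7) by simp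
  then obtain p where p: "distinct p" "successively B p" "p \<noteq> []" "hd p = hd ls" "last p = last ls"
    "length p = 2 * length ls - 1" "set p \<subseteq> set ls \<union> (W - {w, w', z, z'})"
    using alternating_path[OF assms(1) \<open>ls \<noteq> []\<close> finite_sub[OF assms(5)], of "{w, w', z, z'}"] assms(6)
    by blast
  show False
  proof (rule nocyc[of "z # w # p @ [w', z']"])
    show "set (z # w # p @ [w', z']) \<subseteq> V" using p assms by auto
    show "distinct (z # w # p @ [w', z'])" using p assms ne ne' by auto
    show "length (z # w # p @ [w', z']) = 2 * m + 1" using p assms m1 by auto
    show "successively B (z # w # p @ [w', z'])"
      using p assms symB by (auto simp: successively_Cons successively_append_iff)
    show "B (last (z # w # p @ [w', z'])) (hd (z # w # p @ [w', z']))" using assms symB by simp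
  qed
qed

section \<open>Blue cliques and blue neighbourhoods\<close>

lemma no_clique:
  assumes "S \<subseteq> V" "\<And>x y. x \<in> S \<Longrightarrow> y \<in> S \<Longrightarrow> x \<noteq> y \<Longrightarrow> B x y"
  shows "card S \<le> 2 * m"
proof (rule ccontr)
  assume "\<not> ?thesis"
  then obtain S' where S': "S' \<subseteq> S" "card S' = 2 * m + 1"
    by (metis Suc_eq_plus1 not_less_eq_eq obtain_subset_with_card_n)
  then have "finite S'" using assms(1) finite_sub by auto
  then obtain cs where cs: "set cs = S'" "distinct cs" using finite_distinct_list by blast
  then have len: "length cs = 2 * m + 1" using S' distinct_card by fastforce
  have "successively B cs"
    unfolding successively_conv_nth using cs S' assms(2) by (auto simp: nth_eq_iff_index_eq subset_iff)
  moreover have "B (last cs) (hd cs)"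
  proof -
    have "cs \<noteq> []" using len by auto
    then have "last cs \<noteq> hd cs"
      using cs len m1 by (simp add: last_conv_nth hd_conv_nth nth_eq_iff_index_eq)
    then show ?thesis using assms(2)[of "last cs" "hd cs"] cs S' \<open>cs \<noteq> []\<close> by (auto simp: subset_iff)
  qed
  ultimately show False using nocyc[of cs] cs S' len assms(1) by auto
qed

lemma greedy_path:
  assumes S: "S \<subseteq> V" "S \<noteq> {}" and d: "\<And>v. v \<in> S \<Longrightarrow> card {u\<in>S. B v u} \<ge> j"
  shows "\<exists>p. distinct p \<and> length p = j + 1 \<and> set p \<subseteq> S \<and> successively B p"
proof -
  have "i \<le> j \<Longrightarrow> \<exists>p. distinct p \<and> length p = Suc i \<and> set p \<subseteq> S \<and> successively B p" for i
  proof (induction i)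
    case 0
    obtain v where "v \<in> S" using S by auto
    then show ?case by (intro exI[of _ "[v]"]) auto
  next
    case (Suc i)
    then obtain p where p: "distinct p" "length p = Suc i" "set p \<subseteq> S" "successively B p" by auto
    then have ne: "p \<noteq> []" by auto
    let ?N = "{u\<in>S. B (last p) u}"
    have "\<not> ?N \<subseteq> set p - {last p}"
    proof
      assume "?N \<subseteq> set p - {last p}"
      then have "card ?N \<le> card (set p - {last p})" by (intro card_mono) auto
      also have "\<dots> = i" using p ne distinct_card[of p] by simp
      finally show False using d[of "last p"] p(3) last_in_set[OF ne] Suc.prems by auto
    qed
    then obtain u where "u \<in> S" "B (last p) u" "u \<notin> set p" using irrB by auto
    then show ?case using p ne by (intro exI[of _ "p @ [u]"]) (auto simp: successively_append_iff)
  qed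
  then show ?thesis by auto
qed

text \<open>
  A path on \<open>2 m\<close> vertices among the neighbours of \<open>x\<close> would close to an odd cycle, so each set of
  neighbours has a vertex of degree below \<open>2 m - 1\<close>; choose vertices greedily.
\<close>

lemma red_clique_in_nbhd:
  assumes x: "x \<in> V" and "S \<subseteq> V" "\<And>s. s \<in> S \<Longrightarrow> B x s" "card S \<ge> (2 * m - 1) * (t - 1) + 1"
  shows "\<exists>K\<subseteq>S. card K = t \<and> (\<forall>u\<in>K. \<forall>v\<in>K. \<not> B u v)"
  using assms(2-4)
proof (induction t arbitrary: S)
  case 0 then show ?case by (intro exI[of _ "{}"]) auto
next
  case (Suc t)
  have "S \<noteq> {}" using Suc.prems(3) by auto
  obtain v where v: "v \<in> S" "card {u\<in>S. B v u} \<le> 2 * m - 2"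
  proof (rule ccontr)
    assume "\<not> thesis"
    with that have "card {u\<in>S. B v u} \<ge> 2 * m - 1" if "v \<in> S" for v using \<open>v \<in> S\<close> by fastforce
    from greedy_path[OF Suc.prems(1) \<open>S \<noteq> {}\<close> this] obtain p where
      p: "distinct p" "length p = 2 * m - 1 + 1" "set p \<subseteq> S" "successively B p" by blast
    then have "p \<noteq> []" by auto
    have "x \<notin> S" using Suc.prems(2) irrB by auto
    show False
    proof (rule nocyc[of "x # p"])
      show "B (last (x # p)) (hd (x # p))" "successively B (x # p)"
        using p \<open>p \<noteq> []\<close> Suc.prems(2) symB by (auto simp: successively_Cons subset_iff)
    qed (use p x Suc.prems(1) \<open>x \<notin> S\<close> m1 in auto)
  qed
  let ?S = "S - insert v {u\<in>S. B v u}"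
  have finS: "finite S" using Suc.prems(1) finite_sub by blast
  have vn: "v \<notin> {u\<in>S. B v u}" using irrB by auto
  show ?case
  proof (cases "t = 0")
    case True
    then show ?thesis using v irrB by (intro exI[of _ "{v}"]) auto
  next
    case False
    have "card (insert v {u\<in>S. B v u}) \<le> 2 * m - 1"
      using v vn finS m1 by simp
    moreover have "card ?S = card S - card (insert v {u\<in>S. B v u})"
      using v finS by (intro card_Diff_subset) auto
    moreover have "(2 * m - 1) * (Suc t - 1) = (2 * m - 1) * (t - 1) + (2 * m - 1)"
      using False by (cases t) auto
    ultimately have "(2 * m - 1) * (t - 1) + 1 \<le> card ?S" using Suc.prems(3) by linarith
    moreover have "?S \<subseteq> V" "\<And>s. s \<in> ?S \<Longrightarrow> B x s" using Suc.prems by auto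
    ultimately obtain K where K: "K \<subseteq> ?S" "card K = t" "\<forall>u\<in>K. \<forall>v\<in>K. \<not> B u v"
      using Suc.IH[of ?S] by blast
    then have "v \<notin> K" "finite K" using finS by (auto intro: finite_subset[of K S])
    have "\<not> B v u" "\<not> B u v" if "u \<in> K" for u
      using that K(1) symB by auto
    then show ?thesis
      using K v irrB \<open>v \<notin> K\<close> \<open>finite K\<close> by (intro exI[of _ "insert v K"]) auto
  qed
qed

end

section \<open>Embeddings of the sparse graph\<close>

definition red_emb :: "('b \<Rightarrow> 'b \<Rightarrow> bool) \<Rightarrow> 'a set \<Rightarrow> ('a \<times> 'a) set \<Rightarrow> 'b set \<Rightarrow> ('a \<Rightarrow> 'b) \<Rightarrow> bool" where
  "red_emb B A E W f \<longleftrightarrow> inj_on f A \<and> f ` A \<subseteq> W \<and> (\<forall>(u, v) \<in> E. \<not> B (f u) (f v))"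

lemma red_emb_mono: "red_emb B A E W f \<Longrightarrow> W \<subseteq> W' \<Longrightarrow> red_emb B A E W' f"
  by (auto simp: red_emb_def)

text \<open>Blue pairs of the host lie inside \<open>D1\<close> or inside \<open>D2\<close> only, so
  independent sets go there and the rest of \<open>A\<close> goes into \<open>C\<close>.\<close>

lemma embed_two_class:
  assumes g: "sgraph A E" and J: "J1 \<subseteq> A" "J2 \<subseteq> A" "J1 \<inter> J2 = {}" "indep E J1" "indep E J2"
    and fin: "finite C" "finite D1" "finite D2"
    and disj: "C \<inter> D1 = {}" "C \<inter> D2 = {}" "D1 \<inter> D2 = {}"
    and card: "card J1 \<le> card D1" "card J2 \<le> card D2" "card A \<le> card C + card J1 + card J2"
    and red: "\<And>x y. x \<in> C \<Longrightarrow> y \<in> C \<union> D1 \<union> D2 \<Longrightarrow> x \<noteq> y \<Longrightarrow> \<not> B x y \<and> \<not> B y x"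
      "\<And>x y. x \<in> D1 \<Longrightarrow> y \<in> D2 \<Longrightarrow> \<not> B x y \<and> \<not> B y x"
  obtains f where "red_emb B A E (C \<union> D1 \<union> D2) f"
proof -
  note g' = sgraphD[OF g]
  have finJ: "finite J1" "finite J2" using J(1,2) g'(1) by (auto intro: finite_subset)
  obtain f1 where f1: "f1 ` J1 \<subseteq> D1" "inj_on f1 J1"
    using card_le_inj[OF finJ(1) fin(2) card(1)] by auto
  obtain f2 where f2: "f2 ` J2 \<subseteq> D2" "inj_on f2 J2"
    using card_le_inj[OF finJ(2) fin(3) card(2)] by auto
  define K where "K = A - (J1 \<union> J2)"
  have "card K = card A - card (J1 \<union> J2)"
    unfolding K_def using finJ J by (intro card_Diff_subset) auto
  also have "card (J1 \<union> J2) = card J1 + card J2" using finJ J by (intro card_Un_disjoint)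
  finally have "card K \<le> card C" using card(3) by linarith
  moreover have "finite K" using g'(1) by (simp add: K_def)
  ultimately obtain f3 where f3: "f3 ` K \<subseteq> C" "inj_on f3 K"
    using card_le_inj[OF _ fin(1)] by metis
  define f where "f x = (if x \<in> J1 then f1 x else if x \<in> J2 then f2 x else f3 x)" for x
  have fK: "x \<in> K \<Longrightarrow> f x \<in> C" and fJ1: "x \<in> J1 \<Longrightarrow> f x \<in> D1" and fJ2: "x \<in> J2 \<Longrightarrow> f x \<in> D2" for x
    using f1 f2 f3 J(3) by (auto simp: f_def K_def)
  have AK: "x \<in> A \<Longrightarrow> x \<in> K \<or> x \<in> J1 \<or> x \<in> J2" for x by (auto simp: K_def)
  have inj: "inj_on f A"
  proof (rule inj_onI)
    fix x y assume xy: "x \<in> A" "y \<in> A" "f x = f y"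
    consider "x \<in> K" "y \<in> K" | "x \<in> J1" "y \<in> J1" | "x \<in> J2" "y \<in> J2"
      using AK[OF xy(1)] AK[OF xy(2)] fK[of x] fK[of y] fJ1[of x] fJ1[of y] fJ2[of x] fJ2[of y] disj xy(3)
      by fastforce
    then show "x = y"
    proof cases
      case 1
      then have "f3 x = f3 y" using xy by (auto simp: f_def K_def)
      then show ?thesis using 1 f3(2) by (auto dest: inj_onD)
    next
      case 2
      then have "f1 x = f1 y" using xy by (auto simp: f_def)
      then show ?thesis using 2 f1(2) by (auto dest: inj_onD)
    next
      case 3
      then have "x \<notin> J1" "y \<notin> J1" using J(3) by auto
      then have "f2 x = f2 y" using xy 3 by (simp add: f_def)
      then show ?thesis using 3 f2(2) by (auto dest: inj_onD)
    qed
  qed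
  have "f ` A \<subseteq> C \<union> D1 \<union> D2" using AK fK fJ1 fJ2 by blast
  moreover have "\<not> B (f u) (f v)" if "(u, v) \<in> E" for u v
  proof -
    have uv: "u \<in> A" "v \<in> A" "u \<noteq> v" using g' that by auto
    then have ne: "f u \<noteq> f v" using inj by (auto dest: inj_onD)
    have fuv: "f u \<in> C \<union> D1 \<union> D2" "f v \<in> C \<union> D1 \<union> D2"
      using uv \<open>f ` A \<subseteq> C \<union> D1 \<union> D2\<close> by auto
    have "\<not> (u \<in> J1 \<and> v \<in> J1)" "\<not> (u \<in> J2 \<and> v \<in> J2)" using J(4,5) that by (auto simp: indep_def)
    then consider "u \<in> K" | "v \<in> K" | "u \<in> J1" "v \<in> J2" | "u \<in> J2" "v \<in> J1"
      using AK[OF uv(1)] AK[OF uv(2)] by blast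
    then show ?thesis
    proof cases
      case 1
      then show ?thesis using red(1)[OF fK fuv(2) ne] by blast
    next
      case 2
      then show ?thesis using red(1)[OF fK fuv(1) ne[symmetric]] by blast
    next
      case 3
      then show ?thesis using red(2) fJ1 fJ2 by blast
    next
      case 4
      then show ?thesis using red(2) fJ1 fJ2 by blast
    qed
  qed
  ultimately have "red_emb B A E (C \<union> D1 \<union> D2) f"
    using inj by (auto simp: red_emb_def)
  then show thesis by (rule that)
qed

text \<open>
  Here \<open>k = 2 m + 1\<close>, the blue graph \<open>B\<close> is the complement of the host, and \<open>(A, E)\<close> is the sparse
  graph, with at most \<open>n + l\<close> edges; \<open>E\<close> contains both orientations of each of them.
\<close>

locale counterexample = odd_cycle_free V B m
  for V :: "'b set" and B :: "'b \<Rightarrow> 'b \<Rightarrow> bool" and m :: nat +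
  fixes A :: "'a set" and E :: "('a \<times> 'a) set" and n l :: nat
  assumes G: "sgraph A E" and conn: "connected_on A E" and cA: "card A = n"
    and cV: "card V = 2 * n - 1" and cE: "card E \<le> 2 * n + 2 * l"
    and n_ge: "n \<ge> 14 * m + 3" and l_le: "36 * (2 * m + 1)\<^sup>2 * l \<le> n"
    and no_emb: "\<not> red_emb B A E V f"
begin

text \<open>The first form serves the greedy embedding, the second the linear counts. For positive
  \<open>l\<close> the second follows from \<open>14 m + 3 + 100 l \<le> 117 m l\<close>.\<close>

lemma l_bounds: "144 * m * m * l + 144 * m * l \<le> n" "14 * m + 3 + 100 * l \<le> n"
proof -
  have "36 * (2 * m + 1)\<^sup>2 * l = 144 * m * m * l + 144 * m * l + 36 * l"
    by (simp add: power2_eq_square algebra_simps)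
  then show 1: "144 * m * m * l + 144 * m * l \<le> n" using l_le by linarith
  show "14 * m + 3 + 100 * l \<le> n"
  proof (cases "l = 0")
    case True then show ?thesis using n_ge by simp
  next
    case False
    then have "m \<le> m * l" "l \<le> m * l" "1 \<le> m * l" using m1 by auto
    then have "14 * m + 3 + 100 * l \<le> 144 * (m * l)" by linarith
    then show ?thesis using 1 by (simp add: mult.assoc)
  qed
qed

lemma partition:
  obtains T I J where "A = T \<union> I \<union> J" "T \<inter> I = {}" "T \<inter> J = {}" "I \<inter> J = {}"
    "indep E I" "indep E J" "card T \<le> l + 1" "n = card T + card I + card J" "finite T" "finite I" "finite J"
proof -
  have "A \<noteq> {}" using cA n_ge by auto
  obtain T I J where *: "A = T \<union> I \<union> J" "T \<inter> I = {}" "T \<inter> J = {}" "I \<inter> J = {}"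
    "indep E I" "indep E J" "2 * (card T + card A) \<le> card E + 2"
    by (rule near_bipartition[OF G conn \<open>A \<noteq> {}\<close>])
  have fin: "finite T" "finite I" "finite J" using *(1) sgraphD(1)[OF G] by auto
  have "card A = card T + card I + card J"
    unfolding *(1) using fin * by (subst card_Un_disjoint, simp, simp, blast, subst card_Un_disjoint) auto
  then show thesis using that[of T I J] * fin cA cE by simp
qed

section \<open>Hosts that a counterexample rules out\<close>

lemma independent_set:
  assumes "j \<le> 6 * m"
  obtains I where "I \<subseteq> A" "indep E I" "card I = j"
proof -
  obtain T I J where *: "A = T \<union> I \<union> J" "indep E I" "indep E J" "card T \<le> l + 1"
    "n = card T + card I + card J" by (rule partition)
  then have "j \<le> card I \<or> j \<le> card J" using l_bounds(2) assms by linarith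
  then obtain K where "K \<subseteq> A" "indep E K" "j \<le> card K" using * by blast
  moreover from this obtain K' where "K' \<subseteq> K" "card K' = j" by (meson obtain_subset_with_card_n)
  ultimately show thesis using that[of K'] indep_subset by blast
qed

text \<open>An independent set of \<open>n - card C\<close> vertices goes into \<open>D\<close>, the
  rest into \<open>C\<close>, so blue edges inside \<open>D\<close> do no harm. The
  \<open>6 m\<close> is the size that \<open>independent_set\<close> guarantees.\<close>

lemma no_split_host:
  assumes "C \<subseteq> V" "D \<subseteq> V" "C \<inter> D = {}" "card C + card D \<ge> n" "card C + 6 * m \<ge> n"
    and red: "\<And>x y. x \<in> C \<Longrightarrow> y \<in> C \<union> D \<Longrightarrow> x \<noteq> y \<Longrightarrow> \<not> B x y"
  shows False
proof -
  have "n - card C \<le> 6 * m" using assms by simp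
  then obtain I where I: "I \<subseteq> A" "indep E I" "card I = n - card C" by (rule independent_set)
  have red': "\<not> B x y \<and> \<not> B y x" if "x \<in> C" "y \<in> C \<union> D \<union> {}" "x \<noteq> y" for x y
    using red[of x y] that symB by auto
  obtain f where "red_emb B A E (C \<union> D \<union> {}) f"
    by (rule embed_two_class[OF G I(1), of "{}" C D "{}" B])
      (use I assms cA finite_sub red' in \<open>simp_all add: indep_def\<close>)
  then have "red_emb B A E V f" by (rule red_emb_mono) (use assms in auto)
  then show False using no_emb by simp
qed

lemma no_red_clique:
  assumes "C \<subseteq> V" "\<And>x y. x \<in> C \<Longrightarrow> y \<in> C \<Longrightarrow> x \<noteq> y \<Longrightarrow> \<not> B x y"
  shows "card C < n"
proof (rule ccontr)
  assume "\<not> ?thesis"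
  then show False by (intro no_split_host[of C "{}"]) (use assms in auto)
qed

text \<open>The intersection is red to the whole union and the two differences are red to each
  other. So \<open>embed_two_class\<close> applies as soon as independent sets of the sparse graph
  fill the differences far enough.\<close>

lemma union_of_linked:
  assumes X: "X \<subseteq> V" "X' \<subseteq> V" and red: "\<And>x y. x \<in> X \<Longrightarrow> y \<in> X' \<Longrightarrow> \<not> B x y"
    and c: "n + 1 \<le> card X + 3 * m" "n + 1 \<le> card X' + 3 * m" "3 * m + l \<le> card (X \<inter> X') + 1"
  shows "card (X \<union> X') < n"
proof (rule ccontr)
  assume "\<not> ?thesis"
  then have u: "n \<le> card (X \<union> X')" by simp
  define C where "C = X \<inter> X'"
  define D1 where "D1 = X - X'"
  define D2 where "D2 = X' - X"
  have fin: "finite C" "finite D1" "finite D2" using X finite_sub by (auto simp: C_def D1_def D2_def)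
  have disj: "C \<inter> D1 = {}" "C \<inter> D2 = {}" "D1 \<inter> D2 = {}" by (auto simp: C_def D1_def D2_def)
  have eqs: "X = C \<union> D1" "X' = C \<union> D2" "X \<union> X' = C \<union> D1 \<union> D2" by (auto simp: C_def D1_def D2_def)
  have cs: "card X = card C + card D1" "card X' = card C + card D2"
    unfolding eqs(1,2) using fin disj by (simp_all add: card_Un_disjoint)
  have cu: "card C + card D1 + card D2 \<ge> n"
  proof -
    have "card (C \<union> D1 \<union> D2) = card C + card D1 + card D2"
      using fin disj by (subst card_Un_disjoint) (auto simp: card_Un_disjoint)
    then show ?thesis using u eqs(3) by simp
  qed
  have cC: "3 * m + l \<le> card C + 1" using c(3) by (simp add: C_def)
  have no: False if J: "J1 \<subseteq> A" "J2 \<subseteq> A" "J1 \<inter> J2 = {}" "indep E J1" "indep E J2"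
    "card J1 \<le> card D1" "card J2 \<le> card D2" "n \<le> card C + card J1 + card J2" for J1 J2
  proof -
    have r1: "\<not> B x y \<and> \<not> B y x" if "x \<in> C" "y \<in> C \<union> D1 \<union> D2" "x \<noteq> y" for x y
      using that red symB by (auto simp: C_def D1_def D2_def)
    have r2: "\<not> B x y \<and> \<not> B y x" if "x \<in> D1" "y \<in> D2" for x y
      using that red symB by (auto simp: D1_def D2_def)
    obtain f where "red_emb B A E (C \<union> D1 \<union> D2) f"
      by (rule embed_two_class[OF G J(1-5) fin disj J(6-7) _ r1 r2]) (use J(8) cA in auto)
    then have "red_emb B A E V f" by (rule red_emb_mono) (use X eqs in auto)
    then show False using no_emb by simp
  qed
  obtain T I J where P: "A = T \<union> I \<union> J" "I \<inter> J = {}" "indep E I" "indep E J" "card T \<le> l + 1"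
    "n = card T + card I + card J" "finite I" "finite J" by (rule partition)
  \<comment> \<open>A single independent set may be divided between both differences when the
    remaining vertices fit into \<open>C\<close>.\<close>
  have one: False if "K \<subseteq> A" "indep E K" "finite K" "n \<le> card C + card K" for K
  proof -
    define j where "j = min (card D1) (n - card C)"
    have "j \<le> card K" using that(4) by (simp add: j_def)
    then obtain K1 where K1: "K1 \<subseteq> K" "card K1 = j" by (meson obtain_subset_with_card_n)
    have "card (K - K1) = card K - j" using K1 that(3) finite_subset card_Diff_subset by metis
    then have "n - card C - j \<le> card (K - K1)" using that(4) by simp
    then obtain K2 where K2: "K2 \<subseteq> K - K1" "card K2 = n - card C - j"
      by (meson obtain_subset_with_card_n)
    show False
    proof (rule no[of K1 K2])
      show "indep E K1" "indep E K2" using K1 K2 that(2) indep_subset by blast+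
      show "card K2 \<le> card D2" using K2 cu by (auto simp: j_def)
      show "n \<le> card C + card K1 + card K2" using K1(2) K2(2) by linarith
    qed (use K1 K2 that in \<open>auto simp: j_def\<close>)
  qed
  \<comment> \<open>A class of at most \<open>3 m - 2\<close> vertices together with
    \<open>T\<close> has at most \<open>3 m + l - 1 \<le> card C\<close> vertices. If both classes
    are larger, the critical case has all of \<open>I\<close> in \<open>D1\<close> and
    \<open>D2\<close> filled up, where
    \<open>card I + card X' \<ge> (3 m - 1) + (n + 1 - 3 m) = n\<close>; the mirror case is
    alike.\<close>
  consider "card I < 3 * m - 1" | "card J < 3 * m - 1" | "card I \<ge> 3 * m - 1" "card J \<ge> 3 * m - 1"
    by linarith
  then show False
  proof cases
    case 1
    then show False by (intro one[of J]) (use P cC m1 in auto)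
  next
    case 2
    then show False by (intro one[of I]) (use P cC m1 in auto)
  next
    case 3
    obtain J1 where J1: "J1 \<subseteq> I" "card J1 = min (card I) (card D1)"
      by (meson obtain_subset_with_card_n min.cobounded1)
    obtain J2 where J2: "J2 \<subseteq> J" "card J2 = min (card J) (card D2)"
      by (meson obtain_subset_with_card_n min.cobounded1)
    show False
    proof (rule no[of J1 J2])
      show "indep E J1" "indep E J2" using J1 J2 P indep_subset by blast+
      show "n \<le> card C + card J1 + card J2"
        using J1(2) J2(2) 3 cu cs c(1,2) cC P(5,6) m1 by (simp add: min_def split: if_splits)
    qed (use J1 J2 P in auto)
  qed
qed

text \<open>Any two members of \<open>L\<close> have enough common neighbours, so every listing of
  \<open>L\<close> is a chain and any two members can be its ends.\<close>

lemma linked_nonadjacent: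
  assumes m2: "m \<ge> 2" and L: "L \<subseteq> V" "card L = m" and W: "W \<subseteq> V" "W \<inter> L = {}"
    and com: "\<And>x y. x \<in> L \<Longrightarrow> y \<in> L \<Longrightarrow> x \<noteq> y \<Longrightarrow> m + 2 \<le> card {w\<in>W. B x w \<and> B w y}"
    and far: "w \<in> V - L" "w' \<in> V - L" "x \<in> L" "y \<in> L" "x \<noteq> y" "B x w" "B y w'"
  shows "\<not> B w w'"
proof -
  have finL: "finite L" using L finite_sub by auto
  obtain ls where ls: "distinct ls" "set ls \<subseteq> L" "length ls = m" "hd ls = x" "last ls = y"
    by (rule list_with_ends[OF finL far(3,4,5) m2]) (use L in auto)
  have "chain B W (m + 2) ls"
    by (rule chain_const) (use ls com in auto)
  then show ?thesis
    by (rule chain_nbrs_nonadjacent) (use ls far L W in auto)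
qed

text \<open>
  Deleting from \<open>M\<close> a vertex \<open>w\<close> that is the only neighbour in \<open>M\<close> of both ends of a blue edge
  costs one vertex and frees two. Once no such vertex is left, the vertices outside \<open>L\<close> with a
  blue neighbour in \<open>M\<close> form a red clique, completely red to \<open>L\<close>.
\<close>

lemma no_linked_clique:
  assumes m2: "m \<ge> 2" and L: "L \<subseteq> V" "card L = m" and W: "W \<subseteq> V" "W \<inter> L = {}"
    and com: "\<And>x y. x \<in> L \<Longrightarrow> y \<in> L \<Longrightarrow> x \<noteq> y \<Longrightarrow> m + 2 \<le> card {w\<in>W. B x w \<and> B w y}"
    and M: "M \<subseteq> V - L" "\<And>w. w \<in> M \<Longrightarrow> 2 \<le> card {x\<in>L. B x w}"
    and big: "2 * n \<le> card {v\<in>V - L. \<forall>w\<in>M. \<not> B v w} + card M + 6 * m" "n \<le> card M + 6 * m"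
  shows False
proof -
  have finL: "finite L" using L finite_sub by auto
  have ch: "chain B W (m + 2) ls" if "set ls \<subseteq> L" "distinct ls" for ls
    by (rule chain_const) (use that com in auto)
  have other: "\<exists>y\<in>L. B y w \<and> y \<noteq> x" if "w \<in> M" for w x
  proof (rule ccontr)
    assume "\<not> ?thesis"
    then have "{y\<in>L. B y w} \<subseteq> {x}" by auto
    then have "card {y\<in>L. B y w} \<le> 1" using card_mono[of "{x}"] by fastforce
    then show False using M(2)[OF that] by simp
  qed
  note far = linked_nonadjacent[OF m2 L W com]
  have Mred: "\<not> B w w'" if w: "w \<in> M" "w' \<in> M" for w w'
  proof -
    obtain x where "x \<in> L" "B x w" using other[OF w(1)] by blast
    moreover obtain y where "y \<in> L" "B y w'" "y \<noteq> x" using other[OF w(2)] by blast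
    ultimately show ?thesis using far[of w w' x y] M(1) w by blast
  qed
  have F2: False if F2: "z \<in> V - L" "w \<in> M" "B z w" "x \<in> L" "B z x" for z w x
  proof -
    obtain y where "y \<in> L" "B y w" "y \<noteq> x" using other[OF F2(2)] by blast
    then show False using far[of w z y x] F2 M(1) symB by blast
  qed
  have F3: False if "z \<in> V - L" "z' \<in> V - L" "B z z'" "w \<in> M" "w' \<in> M" "w \<noteq> w'" "B z w" "B z' w'" for z z' w w'
  proof -
    have zM: "z \<notin> M" "z' \<notin> M" using that Mred by blast+
    obtain ls where ls: "distinct ls" "set ls \<subseteq> L" "length ls = m - 1" "B (hd ls) w" "B (last ls) w'"
    \<comment> \<open>For \<open>m = 2\<close> the chain is a single vertex that must be adjacent to
      both \<open>w\<close> and \<open>w'\<close>; two neighbours in \<open>L\<close> are then all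
      of \<open>L\<close>.\<close>
    proof (cases "m = 2")
      case True
      obtain x where "x \<in> L" using L m1 by fastforce
      have all: "{x\<in>L. B x u} = L" if "u \<in> M" for u
        using M(2)[OF that] finL L True by (intro card_seteq) auto
      show thesis
        by (rule that[of "[x]"]) (use all[OF \<open>w \<in> M\<close>] all[OF \<open>w' \<in> M\<close>] \<open>x \<in> L\<close> True in auto)
    next
      case False
      obtain x where x: "x \<in> L" "B x w" using other[OF \<open>w \<in> M\<close>] by blast
      obtain y where y: "y \<in> L" "B y w'" "y \<noteq> x" using other[OF \<open>w' \<in> M\<close>] by blast
      show thesis
        by (rule list_with_ends[OF finL x(1) y(1) y(3)[symmetric], of "m - 1"])
          (use False m2 L x y that in auto)
    qed
    show False
      by (rule chain_nbrs_no_path3[OF ch[OF ls(2,1)] ls(3) m2, of w w' z z'])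
        (use ls that L W M zM symB in auto)
  qed
  define \<Phi> where "\<Phi> M' = {v\<in>V - L. \<forall>w\<in>M'. \<not> B v w}" for M'
  have fin\<Phi>: "finite (\<Phi> M')" for M' using finV by (simp add: \<Phi>_def)
  \<comment> \<open>The sum \<open>card (\<Phi> M') + card M'\<close> grows with each deletion. As
    long as \<open>card (\<Phi> M') < n\<close>, its lower bound forces
    \<open>card M' + 6 m > n\<close>, so the other bound survives the loss of one vertex.\<close>
  have "n \<le> card M' + 6 * m \<Longrightarrow> 2 * n \<le> card (\<Phi> M') + card M' + 6 * m \<or> n \<le> card (\<Phi> M') \<Longrightarrow> M' \<subseteq> M \<Longrightarrow> False" for M'
  proof (induction "card M'" arbitrary: M')
    case 0
    then have "n \<le> 6 * m" by simp
    then show False using n_ge by simp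
  next
    case (Suc j)
    have M'V: "M' \<subseteq> V - L" "finite M'" using Suc.prems M finite_sub[of M'] by auto
    have M'\<Phi>: "M' \<subseteq> \<Phi> M'" using Mred Suc.prems(3) M'V by (auto simp: \<Phi>_def)
    show False
    proof (cases "n \<le> card (\<Phi> M')")
      case True
      have "card (\<Phi> M' - M') = card (\<Phi> M') - card M'"
        using M'\<Phi> M'V by (intro card_Diff_subset) auto
      then show False
        using True Suc.prems(1) M'\<Phi> M'V Mred Suc.prems(3) symB
        by (intro no_split_host[of M' "\<Phi> M' - M'"]) (auto simp: \<Phi>_def)
    next
      case False
      then have big': "2 * n \<le> card (\<Phi> M') + card M' + 6 * m" using Suc.prems by simp
      show False
      proof (cases "\<exists>w\<in>M'. \<exists>z\<in>V - L. \<exists>z'\<in>V - L. B z z' \<and> {u\<in>M'. B z u} = {w} \<and> {u\<in>M'. B z' u} = {w}")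
        case True
        then obtain w z z' where w: "w \<in> M'" "z \<in> V - L" "z' \<in> V - L" "B z z'"
          "{u\<in>M'. B z u} = {w}" "{u\<in>M'. B z' u} = {w}" by blast
        have "z \<noteq> z'" "z \<notin> \<Phi> M'" "z' \<notin> \<Phi> M'" using w irrB by (auto simp: \<Phi>_def)
        then have "card (insert z (insert z' (\<Phi> M'))) = card (\<Phi> M') + 2" using fin\<Phi> by simp
        moreover have "insert z (insert z' (\<Phi> M')) \<subseteq> \<Phi> (M' - {w})" using w by (auto simp: \<Phi>_def)
        ultimately have "card (\<Phi> M') + 2 \<le> card (\<Phi> (M' - {w}))" using fin\<Phi> card_mono by metis
        moreover have "card (M' - {w}) = j" using w M'V Suc(2) by simp
        ultimately show False
          using Suc.hyps(1)[of "M' - {w}"] Suc(2) Suc.prems(3) False big' by auto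
      next
        case nobad: False
        define Z where "Z = (V - L) - \<Phi> M'"
        have "card Z = card (V - L) - card (\<Phi> M')"
          unfolding Z_def using fin\<Phi> by (intro card_Diff_subset) (auto simp: \<Phi>_def)
        moreover have "card (V - L) = 2 * n - 1 - m" using L cV finL by (simp add: card_Diff_subset)
        \<comment> \<open>\<open>V - L\<close> has \<open>2 n - 1 - m\<close> vertices, fewer than
          \<open>n\<close> of them in \<open>\<Phi> M'\<close>. The up to \<open>m\<close> vertices
          that \<open>Z\<close> lacks are supplied by \<open>L\<close>, the second part of the split
          host.\<close>
        ultimately have cZ: "card Z + m \<ge> n" using False by simp
        have Zred: "\<not> B x y" if "x \<in> Z" "y \<in> Z" for x y
        proof
          assume xy: "B x y"
          obtain w w' where w: "w \<in> M'" "B x w" "w' \<in> M'" "B y w'" "w \<noteq> w'"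
          proof -
            obtain w where w: "w \<in> M'" "B x w" using \<open>x \<in> Z\<close> by (auto simp: Z_def \<Phi>_def)
            obtain w' where w': "w' \<in> M'" "B y w'" using \<open>y \<in> Z\<close> by (auto simp: Z_def \<Phi>_def)
            have xyV: "x \<in> V - L" "y \<in> V - L" using \<open>x \<in> Z\<close> \<open>y \<in> Z\<close> by (auto simp: Z_def)
            show thesis
            proof (cases "w = w'")
              case True
              then have "\<not> ({u\<in>M'. B x u} = {w} \<and> {u\<in>M'. B y u} = {w})"
                using nobad xy w xyV by blast
              then obtain u where "u \<in> M'" "u \<noteq> w" "B x u \<or> B y u" using w w' True by blast
              then show thesis using that w w' True by blast
            qed (use that w w' in blast)
          qed
          show False
            by (rule F3[of x y w w']) (use that xy w Suc.prems(3) in \<open>auto simp: Z_def\<close>)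
        qed
        have ZL: "\<not> B x y" if "x \<in> Z" "y \<in> L" for x y
        proof
          assume "B x y"
          moreover obtain w where "w \<in> M'" "B x w" using \<open>x \<in> Z\<close> by (auto simp: Z_def \<Phi>_def)
          ultimately show False using F2[of x w y] that Suc.prems(3) by (auto simp: Z_def)
        qed
        show False
          by (rule no_split_host[of Z L]) (use L cZ Zred ZL in \<open>auto simp: Z_def\<close>)
      qed
    qed
  qed
  from this[of M] big show False by (simp add: \<Phi>_def)
qed

end

section \<open>Vertices of high blue degree\<close>

text \<open>A Bonferroni inequality: each of the six pairs contributes at most \<open>c\<close> to
  the overcount.\<close>

lemma card_four_sets:
  assumes "finite W" "A1 \<subseteq> W" "A2 \<subseteq> W" "A3 \<subseteq> W" "A4 \<subseteq> W"
    and "card (A1 \<inter> A2) \<le> c" "card (A1 \<inter> A3) \<le> c" "card (A1 \<inter> A4) \<le> c"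
    "card (A2 \<inter> A3) \<le> c" "card (A2 \<inter> A4) \<le> c" "card (A3 \<inter> A4) \<le> c"
  shows "card A1 + card A2 + card A3 + card A4 \<le> card W + 6 * c"
proof -
  have fin: "finite A1" "finite A2" "finite A3" "finite A4" using assms(1-5) by (auto intro: finite_subset)
  have "card A1 + card A2 = card (A1 \<union> A2) + card (A1 \<inter> A2)"
    using fin by (intro card_Un_Int)
  moreover have "card (A1 \<union> A2) + card A3 = card (A1 \<union> A2 \<union> A3) + card ((A1 \<union> A2) \<inter> A3)"
    using fin by (intro card_Un_Int) auto
  moreover have "card (A1 \<union> A2 \<union> A3) + card A4 = card (A1 \<union> A2 \<union> A3 \<union> A4) + card ((A1 \<union> A2 \<union> A3) \<inter> A4)"
    using fin by (intro card_Un_Int) auto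
  moreover have "card ((A1 \<union> A2) \<inter> A3) \<le> card (A1 \<inter> A3) + card (A2 \<inter> A3)"
    unfolding Int_Un_distrib2 by (rule card_Un_le)
  moreover have "card ((A1 \<union> A2 \<union> A3) \<inter> A4) \<le> card (A1 \<inter> A4) + card (A2 \<inter> A4) + card (A3 \<inter> A4)"
    unfolding Int_Un_distrib2 by (meson add_right_mono card_Un_le le_trans)
  moreover have "card (A1 \<union> A2 \<union> A3 \<union> A4) \<le> card W"
    using assms(1-5) by (intro card_mono) auto
  ultimately show ?thesis using assms(6-11) by linarith
qed

context counterexample
begin

text \<open>For two members of \<open>L\<close>, the common neighbours lie in \<open>M\<close> and
  the union of the neighbourhoods lies in \<open>?\<Phi>\<close>; hence
  \<open>card ?\<Phi> + card M\<close> is at least the sum of the two degrees. The bound on the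
  union makes the intersection, and so \<open>M\<close>, large.\<close>

lemma no_near_equal_nbhds:
  assumes m2: "m \<ge> 2" and L: "L \<subseteq> V" "card L = m" and W: "W \<subseteq> V" "W \<inter> L = {}"
    and com: "\<And>x y. x \<in> L \<Longrightarrow> y \<in> L \<Longrightarrow> x \<noteq> y \<Longrightarrow> m + 2 \<le> card {w\<in>W. B x w \<and> B w y}"
    and deg: "\<And>x. x \<in> L \<Longrightarrow> n + 1 \<le> card {w\<in>W. B x w} + 3 * m"
    and un: "\<And>x y. x \<in> L \<Longrightarrow> y \<in> L \<Longrightarrow> x \<noteq> y \<Longrightarrow> card ({w\<in>W. B x w} \<union> {w\<in>W. B y w}) < n"
  shows False
proof -
  note far = linked_nonadjacent[OF m2 L W com]
  define M where "M = {w\<in>W. 2 \<le> card {x\<in>L. B x w}}"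
  have finL: "finite L" and finW: "finite W" using L W finite_sub by auto
  have other: "\<exists>y\<in>L. B y w \<and> y \<noteq> x" if "w \<in> M" for w x
  proof (rule ccontr)
    assume "\<not> ?thesis"
    then have "{y\<in>L. B y w} \<subseteq> {x}" by auto
    then have "card {y\<in>L. B y w} \<le> 1" using card_mono[of "{x}"] by fastforce
    then show False using that by (simp add: M_def)
  qed
  obtain x y where xy: "x \<in> L" "y \<in> L" "x \<noteq> y"
    using L(2) m2 finL by (metis card_2_iff' card_le_Suc0_iff_eq not_less_eq_eq numeral_2_eq_2)
  let ?X = "{w\<in>W. B x w}" and ?Y = "{w\<in>W. B y w}"
  let ?\<Phi> = "{v\<in>V - L. \<forall>w\<in>M. \<not> B v w}"
  have "\<not> B v w" if v: "v \<in> W" "B z v" "z \<in> L" and w: "w \<in> M" for v w z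
  proof -
    obtain z' where "z' \<in> L" "B z' w" "z' \<noteq> z" using other[OF w] by blast
    then show ?thesis using far[of v w z z'] that W by (auto simp: M_def)
  qed
  then have "?X \<union> ?Y \<subseteq> ?\<Phi>" using xy W by auto
  then have 1: "card (?X \<union> ?Y) \<le> card ?\<Phi>" using finV by (intro card_mono) auto
  have "?X \<inter> ?Y \<subseteq> M"
  proof
    fix w assume w: "w \<in> ?X \<inter> ?Y"
    then have "card {x, y} \<le> card {x\<in>L. B x w}" using xy finL by (intro card_mono) auto
    then show "w \<in> M" using xy w by (simp add: M_def)
  qed
  then have 2: "card (?X \<inter> ?Y) \<le> card M" using finW by (intro card_mono) (auto simp: M_def)
  have 3: "card ?X + card ?Y = card (?X \<union> ?Y) + card (?X \<inter> ?Y)"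
    using finW by (intro card_Un_Int) auto
  note deg[OF xy(1)] deg[OF xy(2)] un[OF xy]
  with 1 2 3 have "2 * n \<le> card ?\<Phi> + card M + 6 * m" "n \<le> card M + 6 * m"
    by linarith+
  then show False
    by (intro no_linked_clique[OF m2 L W com, of M]) (use W in \<open>auto simp: M_def\<close>)
qed

text \<open>
  Either some \<open>q\<^sub>0\<close> has \<open>m\<close> almost disjoint partners, whose neighbourhoods then nearly coincide, or
  any two vertices of \<open>Q\<close> that share many neighbours are ends of a chain. In the second case
  sharing many neighbours is transitive, and there are at most three classes since four
  neighbourhoods cannot be almost disjoint.
\<close>

lemma no_high_blue_set:
  assumes m2: "m \<ge> 2" and Q: "Q \<subseteq> V" "card Q = 3 * m"
    and deg: "\<And>q. q \<in> Q \<Longrightarrow> n + 1 \<le> card {w\<in>V - Q. B q w} + 3 * m"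
  shows False
proof -
  define W where "W = V - Q"
  define N where "N q = {w\<in>W. B q w}" for q
  have finW: "finite W" and finQ: "finite Q" using finV Q finite_sub by (auto simp: W_def)
  have finN: "finite (N q)" for q using finW by (simp add: N_def)
  have NW: "N q \<subseteq> W" for q by (auto simp: N_def)
  have NV: "N q \<subseteq> V" for q by (auto simp: N_def W_def)
  have cW: "card W + 3 * m + 1 = 2 * n"
    unfolding W_def using Q cV finQ n_ge by (simp add: card_Diff_subset)
  have dN: "n + 1 \<le> card (N q) + 3 * m" if "q \<in> Q" for q
    using deg[OF that] by (simp add: N_def W_def)
  have comN: "{w\<in>W. B x w \<and> B w y} = N x \<inter> N y" for x y
    using symB by (auto simp: N_def)
  have uN: "card (N x) + card (N y) = card (N x \<union> N y) + card (N x \<inter> N y)" for x y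
    by (intro card_Un_Int finN)
  have WL: "W \<subseteq> V" "L \<subseteq> Q \<Longrightarrow> W \<inter> L = {}" "L \<subseteq> Q \<Longrightarrow> L \<subseteq> V" for L
    using Q by (auto simp: W_def)
  have key: False if L: "L \<subseteq> Q" "card L = m"
    and "\<And>x y. x \<in> L \<Longrightarrow> y \<in> L \<Longrightarrow> x \<noteq> y \<Longrightarrow> m + 2 \<le> card (N x \<inter> N y)"
    and "\<And>x y. x \<in> L \<Longrightarrow> y \<in> L \<Longrightarrow> x \<noteq> y \<Longrightarrow> card (N x \<union> N y) < n" for L
    by (rule no_near_equal_nbhds[OF m2 WL(3)[OF L(1)] L(2) WL(1) WL(2)[OF L(1)]])
      (use that dN in \<open>auto simp: comN N_def[symmetric]\<close>)
  show False
  proof (cases "\<exists>q0\<in>Q. m \<le> card {q\<in>Q. q \<noteq> q0 \<and> card (N q0 \<inter> N q) < m + 2}")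
    case True
    then obtain q0 L where q0: "q0 \<in> Q" and L: "L \<subseteq> {q\<in>Q. q \<noteq> q0 \<and> card (N q0 \<inter> N q) < m + 2}" "card L = m"
      by (meson obtain_subset_with_card_n)
    then have LQ: "L \<subseteq> Q" by auto
    \<comment> \<open>At most \<open>n - 2\<close> vertices of \<open>W\<close> lie outside
      \<open>N q0\<close>, and \<open>N x\<close> and \<open>N y\<close> each have at least
      \<open>n - 4 m\<close> of them, so they share at least \<open>n - 8 m + 2\<close>.\<close>
    have com: "3 * m + l \<le> card (N x \<inter> N y)" if "x \<in> L" "y \<in> L" for x y
    proof -
      have d: "card (N z) \<le> card (N z - N q0) + (m + 1)" if "z \<in> L" for z
      proof -
        have "card (N z) = card (N z - N q0) + card (N z \<inter> N q0)"
          using finN by (metis card_Diff_subset_Int card_mono finite_Int inf_le1 le_add_diff_inverse2)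
        moreover have "card (N q0 \<inter> N z) < m + 2" using that L by auto
        ultimately show ?thesis by (simp add: Int_commute)
      qed
      have "(N x - N q0) \<union> (N y - N q0) \<subseteq> W - N q0" using NW by auto
      then have "card ((N x - N q0) \<union> (N y - N q0)) \<le> card (W - N q0)" using finW by (intro card_mono) auto
      moreover have "card (W - N q0) = card W - card (N q0)" using NW finN by (intro card_Diff_subset)
      moreover have "card (N x - N q0) + card (N y - N q0) =
          card ((N x - N q0) \<union> (N y - N q0)) + card ((N x - N q0) \<inter> (N y - N q0))"
        using finN by (intro card_Un_Int) auto
      moreover have "card ((N x - N q0) \<inter> (N y - N q0)) \<le> card (N x \<inter> N y)"
        using finN by (intro card_mono) auto
      moreover have "card (N q0) \<le> card W" using NW finW by (intro card_mono)
      moreover have "n + 1 \<le> card (N x) + 3 * m" "n + 1 \<le> card (N y) + 3 * m" "n + 1 \<le> card (N q0) + 3 * m"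
        using dN that LQ q0 by auto
      ultimately show ?thesis using d[OF that(1)] d[OF that(2)] cW l_bounds(2) by linarith
    qed
    have com': "m + 2 \<le> card (N x \<inter> N y)" if "x \<in> L" "y \<in> L" for x y
      using com[OF that] m2 by linarith
    have far: "\<not> B w w'" if "x \<in> L" "y \<in> L" "x \<noteq> y" "w \<in> N x" "w' \<in> N y" for x y w w'
    proof (rule linked_nonadjacent[OF m2 WL(3)[OF LQ] L(2) WL(1) WL(2)[OF LQ], of _ _ x y])
      show "m + 2 \<le> card {w\<in>W. B u w \<and> B w v}" if "u \<in> L" "v \<in> L" for u v
        unfolding comN using com'[OF that] .
    qed (use that LQ in \<open>auto simp: N_def W_def\<close>)
    have un: "card (N x \<union> N y) < n" if "x \<in> L" "y \<in> L" "x \<noteq> y" for x y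
      using com[OF that(1,2)] dN[of x] dN[of y] that LQ NV far[OF that]
      by (intro union_of_linked) auto
    show False by (rule key[OF LQ L(2)]) (use com' un in auto)
  next
    case False
    then have Fdeg: "card {q\<in>Q. q \<noteq> q0 \<and> card (N q0 \<inter> N q) < m + 2} < m" if "q0 \<in> Q" for q0
      using that by (meson not_less)
    let ?F = "\<lambda>q0. {q\<in>Q. q \<noteq> q0 \<and> card (N q0 \<inter> N q) < m + 2}"
    have link: "\<exists>ls. chain B W (m + 2) ls \<and> length ls = m \<and> set ls \<subseteq> Q \<and> hd ls = x \<and> last ls = y"
      if xy: "x \<in> Q" "y \<in> Q" "x \<noteq> y" "m + 2 \<le> card (N x \<inter> N y)" for x y
    proof (cases "m = 2")
      case True
      then show ?thesis using xy by (intro exI[of _ "[x, y]"]) (auto simp: chain_def comN)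
    next
      case False
      let ?P = "\<lambda>p. chain B W (m + 2) p \<and> p \<noteq> [] \<and> set p \<subseteq> Q - {y} \<and> hd p = x"
      \<comment> \<open>At most \<open>(m - 1) + (m - 2) + (m - 1) + 1 = 3 m - 3\<close> of the
        \<open>3 m\<close> vertices of \<open>Q\<close> are excluded. The set \<open>X\<close> is
        empty until the last vertex before \<open>y\<close>, where it is \<open>?F y\<close>, so
        that this vertex is linked to \<open>y\<close> as well.\<close>
      have ext: "\<exists>z\<in>Q - {y}. z \<notin> set p \<and> m + 2 \<le> card (N (last p) \<inter> N z) \<and> z \<notin> X"
        if p: "?P p" "length p \<le> m - 2" "finite X" "card X < m" for p X
      proof -
        have "p \<noteq> []" "set p \<subseteq> Q" using p(1) by auto
        then have "last p \<in> Q" using last_in_set by blast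
        have "card (?F (last p) \<union> set p \<union> X \<union> {y}) \<le> card (?F (last p)) + card (set p) + card X + card {y}"
          using card_Un_le[of "?F (last p) \<union> set p \<union> X" "{y}"] card_Un_le[of "?F (last p) \<union> set p" X]
            card_Un_le[of "?F (last p)" "set p"] by linarith
        also have "\<dots> < card Q"
          using Fdeg[OF \<open>last p \<in> Q\<close>] p card_length[of p] Q(2) m2 by simp
        finally have "\<not> Q \<subseteq> ?F (last p) \<union> set p \<union> X \<union> {y}"
          using card_mono[of "?F (last p) \<union> set p \<union> X \<union> {y}" Q] finQ p by fastforce
        then obtain z where "z \<in> Q" "z \<notin> ?F (last p)" "z \<notin> set p" "z \<notin> X" "z \<noteq> y" by blast
        moreover have "z \<noteq> last p" using \<open>z \<notin> set p\<close> last_in_set[OF \<open>p \<noteq> []\<close>] by auto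
        ultimately show ?thesis by (intro bexI[of _ z]) auto
      qed
      have app: "?P (p @ [z])" if "?P p" "z \<in> Q - {y}" "z \<notin> set p" "m + 2 \<le> card (N (last p) \<inter> N z)" for p z
        using that by (auto simp: chain_def successively_append_iff comN)
      have grow: "Suc i \<le> m - 2 \<Longrightarrow> \<exists>p. ?P p \<and> length p = Suc i" for i
      proof (induction i)
        case 0
        then show ?case using xy by (intro exI[of _ "[x]"]) (auto simp: chain_def)
      next
        case (Suc i)
        then obtain p where p: "?P p" "length p = Suc i" by auto
        obtain z where "z \<in> Q - {y}" "z \<notin> set p" "m + 2 \<le> card (N (last p) \<inter> N z)"
          using ext[OF p(1), of "{}"] p(2) Suc.prems m1 by auto
        then show ?case using app[OF p(1)] p(2) by (intro exI[of _ "p @ [z]"]) auto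
      qed
      have "Suc (m - 3) = m - 2" using m2 False by linarith
      then obtain p where p: "?P p" "length p = m - 2" using grow[of "m - 3"] by auto
      obtain z where z: "z \<in> Q - {y}" "z \<notin> set p" "m + 2 \<le> card (N (last p) \<inter> N z)" "z \<notin> ?F y"
        using ext[OF p(1), of "?F y"] p(2) Fdeg[OF xy(2)] finQ by auto
      have pz: "?P (p @ [z])" using app[OF p(1)] z by blast
      have "m + 2 \<le> card (N z \<inter> N y)" using z by (auto simp: Int_commute)
      then have "chain B W (m + 2) ((p @ [z]) @ [y])"
        using pz by (auto simp: chain_def successively_append_iff comN)
      then show ?thesis
        using p pz xy z m2 False by (intro exI[of _ "(p @ [z]) @ [y]"]) auto
    qed
    \<comment> \<open>The threshold \<open>3 m + l - 1\<close> is the one required by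
      \<open>union_of_linked\<close>; it is at least \<open>m + 2\<close>, so \<open>link\<close>
      applies.\<close>
    let ?near = "\<lambda>x y. x = y \<or> 3 * m + l \<le> card (N x \<inter> N y) + 1"
    have un: "card (N x \<union> N y) < n" if xy: "x \<in> Q" "y \<in> Q" "x \<noteq> y" "3 * m + l \<le> card (N x \<inter> N y) + 1" for x y
    proof -
      have "m + 2 \<le> card (N x \<inter> N y)" using xy(4) m2 by linarith
      then obtain ls where ls: "chain B W (m + 2) ls" "length ls = m" "set ls \<subseteq> Q" "hd ls = x" "last ls = y"
        using link xy by blast
      have "\<not> B w w'" if "w \<in> N x" "w' \<in> N y" for w w'
        by (rule chain_nbrs_nonadjacent[OF ls(1,2)]) (use that ls Q in \<open>auto simp: N_def W_def\<close>)
      then show ?thesis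
        using xy dN[of x] dN[of y] NV by (intro union_of_linked) auto
    qed
    \<comment> \<open>Since the two unions are smaller than \<open>n\<close>, \<open>N x\<close> and
      \<open>N z\<close> both contain nearly all of \<open>N y\<close>. They share at least
      \<open>card (N x) + card (N y) + card (N z) - 2 (n - 1) \<ge> n - 9 m + 5\<close>
      vertices.\<close>
    have trans: "?near x z" if "x \<in> Q" "y \<in> Q" "z \<in> Q" "?near x y" "?near y z" for x y z
    proof (cases "x = y \<or> y = z \<or> x = z")
      case True then show ?thesis using that by auto
    next
      case False
      have "card (N x \<union> N y) < n" "card (N y \<union> N z) < n" using un that False by auto
      moreover have "card (N y \<inter> N x) + card (N y \<inter> N z) =
          card ((N y \<inter> N x) \<union> (N y \<inter> N z)) + card ((N y \<inter> N x) \<inter> (N y \<inter> N z))"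
        using finN by (intro card_Un_Int) auto
      moreover have "card ((N y \<inter> N x) \<union> (N y \<inter> N z)) \<le> card (N y)" using finN by (intro card_mono) auto
      moreover have "card ((N y \<inter> N x) \<inter> (N y \<inter> N z)) \<le> card (N x \<inter> N z)" using finN by (intro card_mono) auto
      moreover have "card (N x \<inter> N y) = card (N y \<inter> N x)" by (simp add: Int_commute)
      ultimately have "3 * m + l \<le> card (N x \<inter> N z) + 1"
        using uN[of x y] uN[of y z] dN[OF that(1)] dN[OF that(2)] dN[OF that(3)] l_bounds(2) by linarith
      then show ?thesis by simp
    qed
    have sym: "?near x y \<longleftrightarrow> ?near y x" for x y by (auto simp: Int_commute)
    let ?cls = "\<lambda>x. {y\<in>Q. ?near x y}"
    have "card (?cls x) < m" if "x \<in> Q" for x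
    proof (rule ccontr)
      assume "\<not> ?thesis"
      then have "m \<le> card (?cls x)" by simp
      then obtain L where L: "L \<subseteq> ?cls x" "card L = m" by (meson obtain_subset_with_card_n)
      then have LQ: "L \<subseteq> Q" and near: "\<And>y. y \<in> L \<Longrightarrow> ?near x y" by blast+
      have nr: "3 * m + l \<le> card (N y \<inter> N z) + 1" if yz: "y \<in> L" "z \<in> L" "y \<noteq> z" for y z
      proof -
        have "?near y x" using near[OF yz(1)] sym[of x y] by blast
        moreover have "?near x z" by (rule near[OF yz(2)])
        ultimately have "?near y z" using trans[of y x z] yz LQ \<open>x \<in> Q\<close> by blast
        then show ?thesis using yz(3) by blast
      qed
      show False
      proof (rule key[OF LQ L(2)])
        fix y z assume yz: "y \<in> L" "z \<in> L" "y \<noteq> z"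
        show "m + 2 \<le> card (N y \<inter> N z)" using nr[OF yz] m2 by linarith
        show "card (N y \<union> N z) < n" using un[of y z] nr[OF yz] yz LQ by blast
      qed
    qed
    then have cl: "card (?cls x) \<le> m - 1" if "x \<in> Q" for x using that by fastforce
    have ex: "\<exists>z\<in>Q. z \<notin> X" if "card X < 3 * m" "finite X" for X
      using that Q(2) card_mono[of X Q] by fastforce
    have fc: "finite (?cls x)" for x using finQ by simp
    obtain q1 where q1: "q1 \<in> Q" using ex[of "{}"] m1 by auto
    have "card (?cls q1) < 3 * m" using cl[OF q1] m1 by linarith
    then obtain q2 where q2: "q2 \<in> Q" "q2 \<notin> ?cls q1" using ex[OF _ fc] by blast
    have "card (?cls q1 \<union> ?cls q2) < 3 * m"
      using card_Un_le[of "?cls q1" "?cls q2"] cl[OF q1] cl[OF q2(1)] m1 by linarith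
    then obtain q3 where q3: "q3 \<in> Q" "q3 \<notin> ?cls q1" "q3 \<notin> ?cls q2"
      using ex[of "?cls q1 \<union> ?cls q2"] fc by blast
    have "card (?cls q1 \<union> ?cls q2 \<union> ?cls q3) < 3 * m"
      using card_Un_le[of "?cls q1 \<union> ?cls q2" "?cls q3"] card_Un_le[of "?cls q1" "?cls q2"]
        cl[OF q1] cl[OF q2(1)] cl[OF q3(1)] m1 by linarith
    then obtain q4 where q4: "q4 \<in> Q" "q4 \<notin> ?cls q1" "q4 \<notin> ?cls q2" "q4 \<notin> ?cls q3"
      using ex[of "?cls q1 \<union> ?cls q2 \<union> ?cls q3"] fc by blast
    \<comment> \<open>Members of distinct classes share at most \<open>3 m + l - 2\<close>
      neighbours, while \<open>W\<close> has only \<open>2 n - 1 - 3 m\<close> vertices.\<close>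
    have "card (N q1) + card (N q2) + card (N q3) + card (N q4) \<le> card W + 6 * (3 * m + l - 2)"
      by (rule card_four_sets[OF finW NW NW NW NW]) (use q1 q2 q3 q4 m2 in auto)
    then show False using dN[OF q1] dN[OF q2(1)] dN[OF q3(1)] dN[OF q4(1)] cW l_bounds(2) m2 by linarith
  qed
qed

end

section \<open>Lengthening red paths\<close>

lemma successively_insert:
  assumes "successively R xs" "Suc i < length xs" "R (xs ! i) y" "R y (xs ! Suc i)"
  shows "successively R (take (Suc i) xs @ y # drop (Suc i) xs)"
proof -
  have "successively R (take (Suc i) xs @ drop (Suc i) xs)" using assms(1) by simp
  moreover have "take (Suc i) xs \<noteq> []" "last (take (Suc i) xs) = xs ! i"
    using assms(2) by (auto simp: take_Suc_conv_app_nth)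
  moreover have "hd (drop (Suc i) xs) = xs ! Suc i" using assms(2) by (simp add: hd_drop_conv_nth)
  ultimately show ?thesis
    using assms(3,4) by (auto simp: successively_append_iff successively_Cons simp del: append_take_drop_id)
qed

lemma successively_reroute:
  assumes "successively R xs" "i < j" "j < length xs" "zs \<noteq> []" "successively R zs"
    "R (xs ! i) (hd zs)" "R (last zs) (xs ! j)"
  shows "successively R (take (Suc i) xs @ zs @ drop j xs)"
proof -
  have "successively R (take (Suc i) xs @ drop (Suc i) xs)" "successively R (take j xs @ drop j xs)"
    using assms(1) by simp_all
  then have "successively R (take (Suc i) xs)" "successively R (drop j xs)"
    unfolding successively_append_iff by blast+
  moreover have "take (Suc i) xs \<noteq> []" "last (take (Suc i) xs) = xs ! i"
    using assms(2,3) by (auto simp: take_Suc_conv_app_nth)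
  moreover have "hd (drop j xs) = xs ! j" using assms(3) by (simp add: hd_drop_conv_nth)
  ultimately show ?thesis
    using assms(4-7) by (auto simp: successively_append_iff)
qed

lemma successively_rotate:
  assumes "successively R (as @ bs @ cs)" "as \<noteq> []" "bs \<noteq> []" "cs \<noteq> []" "\<And>x y. R x y \<Longrightarrow> R y x"
    "R (last as) y" "R y (last bs)" "R (hd bs) (hd cs)"
  shows "successively R (as @ y # rev bs @ cs)"
proof -
  have "successively (\<lambda>x y. R y x) bs"
    using assms(1,5) by (auto simp: successively_append_iff elim: successively_mono)
  then show ?thesis
    using assms by (auto simp: successively_append_iff successively_Cons successively_rev hd_rev last_rev)
qed

context counterexample
begin

text \<open>What undoing a suppression needs: the ends stay, the length grows by one, and interior
  vertices may be exchanged for vertices of \<open>Y\<close>.\<close>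

definition longer_path :: "'b list \<Rightarrow> 'b set \<Rightarrow> 'b list \<Rightarrow> bool" where
  "longer_path xs Y zs \<longleftrightarrow> distinct zs \<and> length zs = Suc (length xs) \<and> hd zs = hd xs \<and> last zs = last xs \<and>
     set zs \<subseteq> set xs \<union> Y \<and> successively (\<lambda>x y. \<not> B x y) zs"

text \<open>
  If \<open>y\<close> has red neighbours \<open>x\<^sub>i\<close> and \<open>x\<^sub>j\<close> on the path, then it can be inserted, or the path can be
  rotated around it, unless \<open>y\<close>, \<open>x\<^sub>i\<^sub>+\<^sub>1\<close> and \<open>x\<^sub>j\<^sub>+\<^sub>1\<close> are pairwise blue.
\<close>

lemma longer_path_of_blue_edge:
  assumes xs: "distinct xs" "length xs = 5 * m - 1" "set xs \<subseteq> V" "successively (\<lambda>x y. \<not> B x y) xs"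
    and Y: "Y \<subseteq> V" "Y \<inter> set xs = {}" "card Y \<ge> m + 1" and y12: "y1 \<in> Y" "y2 \<in> Y" "B y1 y2"
  shows "\<exists>zs. longer_path xs Y zs"
proof (rule ccontr)
  assume no: "\<not> ?thesis"
  let ?R = "\<lambda>x y. \<not> B x y"
  have symR: "?R x y \<Longrightarrow> ?R y x" for x y using symB by blast
  have xs_ne: "xs \<noteq> []" using xs(2) m1 by auto
  have ins: "B y (xs ! Suc i)" if y: "y \<in> Y" "?R y (xs ! i)" "Suc i < length xs" for y i
  proof (rule ccontr)
    assume "?R y (xs ! Suc i)"
    then have "successively ?R (take (Suc i) xs @ y # drop (Suc i) xs)"
      using y symR xs(4) by (intro successively_insert) auto
    moreover have "set (take (Suc i) xs @ y # drop (Suc i) xs) = insert y (set xs)"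
      by (metis Un_insert_right append_take_drop_id list.simps(15) set_append)
    moreover have "distinct (take (Suc i) xs @ y # drop (Suc i) xs)"
    proof -
      have "distinct (take (Suc i) xs @ drop (Suc i) xs)" using xs(1) by simp
      moreover have "y \<notin> set (take (Suc i) xs @ drop (Suc i) xs)" using y(1) Y(2) by auto
      ultimately show ?thesis by (auto simp del: append_take_drop_id)
    qed
    moreover have "hd (take (Suc i) xs @ y # drop (Suc i) xs) = hd xs" using y(3) xs_ne by (cases xs) auto
    moreover have "last (take (Suc i) xs @ y # drop (Suc i) xs) = last xs" using y(3) by simp
    moreover have "length (take (Suc i) xs @ y # drop (Suc i) xs) = Suc (length xs)" using y(3) by simp
    ultimately have "longer_path xs Y (take (Suc i) xs @ y # drop (Suc i) xs)"
      unfolding longer_path_def using y(1) by simp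
    then show False using no by blast
  qed
  have rot: "B (xs ! Suc i) (xs ! Suc j)"
    if y: "y \<in> Y" "?R y (xs ! i)" "?R y (xs ! j)" "i < j" "Suc j < length xs" for y i j
  proof (rule ccontr)
    assume R: "?R (xs ! Suc i) (xs ! Suc j)"
    define as where "as = take (Suc i) xs"
    define bs where "bs = take (j - i) (drop (Suc i) xs)"
    define cs where "cs = drop (Suc j) xs"
    have bc: "bs @ cs = drop (Suc i) xs"
      using y(4) append_take_drop_id[of "j - i" "drop (Suc i) xs"] by (simp add: bs_def cs_def)
    then have eq: "as @ bs @ cs = xs" by (simp add: as_def)
    have ne: "as \<noteq> []" "bs \<noteq> []" "cs \<noteq> []" using y(4,5) by (auto simp: as_def bs_def cs_def)
    have ends: "last as = xs ! i" "hd bs = xs ! Suc i" "last bs = xs ! j" "hd cs = xs ! Suc j"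
      using y(4,5) ne by (auto simp: as_def bs_def cs_def last_conv_nth hd_conv_nth min_def)
    let ?zs = "as @ y # rev bs @ cs"
    have "successively ?R ?zs"
      using xs(4) ne symR y R ends eq by (intro successively_rotate) auto
    moreover have "set ?zs = insert y (set xs)" unfolding eq[symmetric] by auto
    moreover have "distinct ?zs"
    proof -
      have "distinct (as @ bs @ cs)" "y \<notin> set (as @ bs @ cs)" using xs(1) y(1) Y(2) eq by auto
      then show ?thesis by auto
    qed
    moreover have "hd ?zs = hd xs" "last ?zs = last xs" "length ?zs = Suc (length xs)"
      unfolding eq[symmetric] using ne by auto
    ultimately have "longer_path xs Y ?zs"
      unfolding longer_path_def using y(1) by simp
    then show False using no by blast
  qed
  define X where "X = (\<lambda>i. xs ! i) ` {i. Suc i < length xs}"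
  have injx: "inj_on (\<lambda>i. xs ! i) {i. i < length xs}" using xs(1) by (auto intro!: inj_onI simp: nth_eq_iff_index_eq)
  have cX: "card X = 5 * m - 2"
  proof -
    have "{i. Suc i < length xs} = {..<length xs - 1}" by auto
    then have "card {i. Suc i < length xs} = 5 * m - 2" using xs(2) by simp
    moreover have "inj_on (\<lambda>i. xs ! i) {i. Suc i < length xs}" using injx by (rule inj_on_subset) auto
    ultimately show ?thesis unfolding X_def by (simp add: card_image)
  qed
  have XV: "X \<subseteq> set xs" by (auto simp: X_def)
  then have finX: "finite X" using finite_subset by blast
  \<comment> \<open>Replacing each red neighbour of \<open>y\<close> by its successor gives a set
    that forms a blue clique together with \<open>y\<close>. This is why \<open>X\<close> contains
    only vertices with a successor.\<close>
  have few: "card {x\<in>X. ?R y x} \<le> 2 * m - 1" if y: "y \<in> Y" for y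
  proof -
    define J where "J = {i. Suc i < length xs \<and> ?R y (xs ! i)}"
    have finJ: "finite J" by (rule finite_subset[of _ "{..length xs}"]) (auto simp: J_def)
    define S where "S = (\<lambda>i. xs ! Suc i) ` J"
    have "{x\<in>X. ?R y x} = (\<lambda>i. xs ! i) ` J" by (auto simp: X_def J_def)
    then have "card {x\<in>X. ?R y x} \<le> card J" using finJ card_image_le by metis
    also have "card J = card S"
      unfolding S_def using xs(1) by (intro card_image[symmetric] inj_onI) (auto simp: J_def nth_eq_iff_index_eq)
    finally have 1: "card {x\<in>X. ?R y x} \<le> card S" .
    have "S \<subseteq> set xs" by (auto simp: S_def J_def)
    then have "y \<notin> S" "finite S" using y Y(2) finite_subset by blast+
    then have "card (insert y S) = Suc (card S)" by simp
    moreover have "card (insert y S) \<le> 2 * m"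
    proof (rule no_clique)
      show "insert y S \<subseteq> V" using \<open>S \<subseteq> set xs\<close> xs(3) y Y(1) by blast
      have yS: "B y s" if "s \<in> S" for s using ins[OF y] that by (auto simp: S_def J_def)
      have SS: "B s s'" if "s \<in> S" "s' \<in> S" "s \<noteq> s'" for s s'
      proof -
        from that obtain i j where ij: "i \<in> J" "j \<in> J" "s = xs ! Suc i" "s' = xs ! Suc j" by (auto simp: S_def)
        then have "i \<noteq> j" using that by auto
        then show ?thesis using rot[OF y, of i j] rot[OF y, of j i] ij symB
          by (auto simp: J_def neq_iff)
      qed
      show "B u v" if "u \<in> insert y S" "v \<in> insert y S" "u \<noteq> v" for u v
        using that yS SS symB by blast
    qed
    ultimately show ?thesis using 1 by linarith
  qed
  have com: "m \<le> card {x\<in>X. B u x \<and> B x v}" if "u \<in> Y" "v \<in> Y" for u v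
  proof -
    have "X = {x\<in>X. B u x \<and> B x v} \<union> ({x\<in>X. ?R u x} \<union> {x\<in>X. ?R v x})" using symB by auto
    then have "card X \<le> card {x\<in>X. B u x \<and> B x v} + (card {x\<in>X. ?R u x} + card {x\<in>X. ?R v x})"
      by (metis (no_types, lifting) add_left_mono card_Un_le le_trans)
    then show ?thesis using few[OF that(1)] few[OF that(2)] cX m1 by linarith
  qed
  have "y2 \<noteq> y1" using y12 irrB by auto
  \<comment> \<open>The blue edge \<open>y1 y2\<close> will close an alternating path through
    \<open>m + 1\<close> vertices of \<open>Y\<close> and \<open>m\<close> of
    \<open>X\<close>.\<close>
  obtain ls where ls: "distinct ls" "set ls \<subseteq> Y" "length ls = m + 1" "hd ls = y2" "last ls = y1"
    by (rule list_with_ends[OF finite_sub[OF Y(1)] y12(2,1) \<open>y2 \<noteq> y1\<close>, of "m + 1"]) (use m1 Y(3) in auto)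
  have "chain B X m ls" by (rule chain_const) (use ls com in auto)
  then have "\<not> B (last ls) (hd ls)"
    by (rule chain_ends_nonadjacent) (use ls XV xs(3) Y in auto)
  then show False using ls y12 by simp
qed

text \<open>Either a detour through the red clique \<open>Y\<close> replaces a piece of the path, or
  nearly all path vertices are blue to all of \<open>Y\<close> but one vertex. Then \<open>m\<close>
  of them and the rest of \<open>Y\<close> serve as \<open>L\<close> and \<open>M\<close> in
  \<open>no_linked_clique\<close>.\<close>

lemma longer_path_of_red_clique:
  assumes m2: "m \<ge> 2" and xs: "distinct xs" "length xs = 5 * m - 1" "set xs \<subseteq> V" "successively (\<lambda>x y. \<not> B x y) xs"
    and Y: "Y \<subseteq> V" "Y \<inter> set xs = {}" "n + 1 \<le> card Y + 3 * m" and Yred: "\<And>x y. x \<in> Y \<Longrightarrow> y \<in> Y \<Longrightarrow> \<not> B x y"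
  shows "\<exists>zs. longer_path xs Y zs"
proof (rule ccontr)
  assume no: "\<not> ?thesis"
  let ?R = "\<lambda>x y. \<not> B x y"
  have xs_ne: "xs \<noteq> []" using xs(2) m1 by auto
  have finY: "finite Y" using Y(1) finite_sub by auto
  \<comment> \<open>A detour trades the \<open>j - i - 1\<close> vertices strictly between the two
    positions for \<open>j - i\<close> vertices of \<open>Y\<close>; \<open>j - i \<ge> 2\<close>
    leaves room for its two distinct ends.\<close>
  have close: "j \<le> Suc i" if ij: "j < length xs" "y \<in> Y" "y' \<in> Y" "y \<noteq> y'" "?R (xs ! i) y" "?R (xs ! j) y'" for i j y y'
  proof (rule ccontr)
    assume "\<not> ?thesis"
    then have d: "Suc (Suc i) \<le> j" by simp
    have "j - i \<le> card Y" using ij(1) xs(2) Y(3) n_ge by linarith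
    then obtain zs where zs: "distinct zs" "set zs \<subseteq> Y" "length zs = j - i" "hd zs = y" "last zs = y'"
      by (rule list_with_ends[OF finY ij(2-4), rotated]) (use d in auto)
    have "zs \<noteq> []" using zs(3) d by auto
    let ?zs = "take (Suc i) xs @ zs @ drop j xs"
    have "successively ?R zs"
      unfolding successively_conv_nth using zs(2) Yred by (auto simp: subset_iff)
    then have "successively ?R ?zs"
      using d ij symB zs xs(4) \<open>zs \<noteq> []\<close> by (intro successively_reroute) auto
    moreover have "set ?zs \<subseteq> set xs \<union> Y" using zs(2) set_take_subset set_drop_subset by fastforce
    moreover have "distinct ?zs"
    proof -
      have "set (take (Suc i) xs) \<inter> set (drop j xs) = {}"
        using xs(1) d by (intro set_take_disj_set_drop_if_distinct) auto
      moreover have "set (take (Suc i) xs) \<subseteq> set xs" "set (drop j xs) \<subseteq> set xs"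
        by (auto dest: in_set_takeD in_set_dropD)
      ultimately show ?thesis using xs(1) zs(1,2) Y(2) by auto
    qed
    moreover have "hd ?zs = hd xs" using xs_ne by (cases xs) auto
    moreover have "last ?zs = last xs" using ij(1) by simp
    moreover have "length ?zs = Suc (length xs)" using d ij(1) zs(3) by simp
    ultimately have "longer_path xs Y ?zs" unfolding longer_path_def by simp
    then show False using no by blast
  qed
  define I where "I y0 = {i. i < length xs \<and> (\<exists>y\<in>Y - {y0}. ?R (xs ! i) y)}" for y0
  \<comment> \<open>Red edges to distinct vertices of \<open>Y\<close> start at positions at most
    one apart. Given two such edges, every red edge starts within one of \<open>i\<close> or of
    \<open>j\<close>, in two intervals of at most three positions. Otherwise all red edges end in
    one vertex of \<open>Y\<close>, which is left out as \<open>y0\<close>.\<close>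
  have "\<exists>y0. card (I y0) \<le> 6"
  proof (cases "\<exists>i j y y'. i < length xs \<and> j < length xs \<and> y \<in> Y \<and> y' \<in> Y \<and> y \<noteq> y' \<and> ?R (xs ! i) y \<and> ?R (xs ! j) y'")
    case True
    then obtain i j y y' where ij: "i < length xs" "j < length xs" "y \<in> Y" "y' \<in> Y" "y \<noteq> y'" "?R (xs ! i) y" "?R (xs ! j) y'"
      by blast
    have "I y0 \<subseteq> {i - 1..Suc i} \<union> {j - 1..Suc j}" for y0
    proof
      fix h assume "h \<in> I y0"
      then obtain z where h: "h < length xs" "z \<in> Y" "?R (xs ! h) z" by (auto simp: I_def)
      show "h \<in> {i - 1..Suc i} \<union> {j - 1..Suc j}"
      proof (cases "z = y")
        case True
        then have "h \<le> Suc j" "j \<le> Suc h"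
          using close[of h y' z j] close[of j z y' h] h ij by auto
        then show ?thesis by auto
      next
        case False
        then have "h \<le> Suc i" "i \<le> Suc h"
          using close[of h y z i] close[of i z y h] h ij by auto
        then show ?thesis by auto
      qed
    qed
    then have "card (I y) \<le> card ({i - 1..Suc i} \<union> {j - 1..Suc j})" by (intro card_mono) auto
    also have "\<dots> \<le> card {i - 1..Suc i} + card {j - 1..Suc j}" by (rule card_Un_le)
    also have "\<dots> \<le> 6" by simp
    finally show ?thesis by blast
  next
    case False
    show ?thesis
    proof (cases "\<exists>i y. i < length xs \<and> y \<in> Y \<and> ?R (xs ! i) y")
      case True
      then obtain i y where iy: "i < length xs" "y \<in> Y" "?R (xs ! i) y" by blast
      have "I y = {}" unfolding I_def using False iy by blast
      then show ?thesis by (intro exI[of _ y]) simp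
    next
      case False
      then have "I y = {}" for y unfolding I_def by blast
      then show ?thesis by simp
    qed
  qed
  then obtain y0 where y0: "card (I y0) \<le> 6" ..
  define L0 where "L0 = (\<lambda>i. xs ! i) ` ({..<length xs} - I y0)"
  have "card L0 = card ({..<length xs} - I y0)"
    unfolding L0_def using xs(1) by (intro card_image inj_onI) (auto simp: nth_eq_iff_index_eq)
  moreover have "card ({..<length xs} - I y0) \<ge> card {..<length xs} - card (I y0)"
    by (rule diff_card_le_card_Diff) (auto simp: I_def)
  ultimately have "card L0 \<ge> m" using y0 xs(2) m2 by simp
  then obtain L where L: "L \<subseteq> L0" "card L = m" by (meson obtain_subset_with_card_n)
  define M where "M = Y - {y0}"
  have LM: "B x w" if "x \<in> L" "w \<in> M" for x w
    using that L(1) by (auto simp: L0_def I_def M_def)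
  have Lxs: "L \<subseteq> set xs" using L(1) by (auto simp: L0_def)
  have cM: "n \<le> card M + 3 * m"
    using Y(3) finY card_Diff1_le[of Y y0] by (auto simp: M_def card_Diff_singleton_if)
  have MV: "M \<subseteq> V - L" using Y Lxs by (auto simp: M_def)
  have "{w\<in>M. B x w \<and> B w y} = M" if "x \<in> L" "y \<in> L" for x y using that LM symB by auto
  then have com: "m + 2 \<le> card {w\<in>M. B x w \<and> B w y}" if "x \<in> L" "y \<in> L" for x y
    using that cM n_ge by simp
  have "{x\<in>L. B x w} = L" if "w \<in> M" for w using that LM by auto
  then have dM: "2 \<le> card {x\<in>L. B x w}" if "w \<in> M" for w using that L(2) m2 by simp
  have "M \<subseteq> {v\<in>V - L. \<forall>w\<in>M. \<not> B v w}" using MV Yred by (auto simp: M_def)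
  then have "card M \<le> card {v\<in>V - L. \<forall>w\<in>M. \<not> B v w}" using finV by (intro card_mono) auto
  then show False
    using cM by (intro no_linked_clique[OF m2 _ L(2), of M M]) (use com dM MV Lxs xs(3) in auto)
qed

end

section \<open>Hosts of large red minimum degree\<close>

lemma red_emb_extend:
  assumes g: "sgraph A E" and f: "red_emb B A' (Restr E A') W f" and A: "A = insert v A'" "v \<notin> A'"
    and y: "y \<in> W" "y \<notin> f ` A'" "\<And>u. u \<in> A' \<Longrightarrow> (v, u) \<in> E \<Longrightarrow> \<not> B (f u) y \<and> \<not> B y (f u)"
  shows "red_emb B A E W (f(v := y))"
  unfolding red_emb_def
proof (intro conjI)
  note g' = sgraphD[OF g]
  show "inj_on (f(v := y)) A"
    unfolding A(1) using f A(2) y(2) by (auto simp: red_emb_def inj_on_def)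
  show "(f(v := y)) ` A \<subseteq> W" using f A y(1) by (auto simp: red_emb_def)
  have "\<not> B ((f(v := y)) a) ((f(v := y)) b)" if "(a, b) \<in> E" for a b
  proof -
    have ab: "a \<in> A" "b \<in> A" "a \<noteq> b" "(b, a) \<in> E" using g' that by auto
    consider "a = v" "b \<in> A'" | "b = v" "a \<in> A'" | "a \<in> A'" "b \<in> A'" using ab A by auto
    then show ?thesis
    proof cases
      case 3
      then have "a \<noteq> v" "b \<noteq> v" "(a, b) \<in> Restr E A'" using A(2) that by auto
      then show ?thesis using f by (auto simp: red_emb_def)
    qed (use y(3) that ab in auto)
  qed
  then show "\<forall>(a, b)\<in>E. \<not> B ((f(v := y)) a) ((f(v := y)) b)"
    by (auto simp del: fun_upd_apply)
qed

lemma red_emb_into_clique: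
  assumes f: "f ` A \<subseteq> K" "inj_on f A" and K: "K \<subseteq> W" "\<And>x y. x \<in> K \<Longrightarrow> y \<in> K \<Longrightarrow> \<not> B x y"
    and E: "E \<subseteq> A \<times> A"
  shows "red_emb B A E W f"
proof -
  have "\<not> B (f u) (f v)" if "(u, v) \<in> E" for u v
    using that E f(1) by (intro K(2)) auto
  then show ?thesis using f K(1) by (auto simp: red_emb_def)
qed

locale dense_host = counterexample V B m A E n l
  for V :: "'b set" and B :: "'b \<Rightarrow> 'b \<Rightarrow> bool" and m :: nat
    and A :: "'a set" and E :: "('a \<times> 'a) set" and n l :: nat +
  fixes W :: "'b set"
  assumes WV: "W \<subseteq> V" and cW: "2 * n \<le> card W + 3 * m" and W1: "m = 1 \<Longrightarrow> W = V"
    and red_deg: "x \<in> W \<Longrightarrow> n \<le> card {u\<in>W. u \<noteq> x \<and> \<not> B x u} + 1"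
begin

lemma finW: "finite W" using WV finite_sub by simp

text \<open>\<open>x\<close> belongs to \<open>S\<close> but is not its own neighbour, so
  \<open>S\<close> blocks at most \<open>card S - 1\<close> of at least \<open>n - 1\<close> red
  neighbours. This exactness lets pendant vertices be added up to order \<open>n\<close>.\<close>

lemma free_red_nbrs:
  assumes "x \<in> S" "S \<subseteq> W"
  shows "n \<le> card ({u\<in>W. u \<noteq> x \<and> \<not> B x u} - S) + card S"
proof -
  let ?N = "{u\<in>W. u \<noteq> x \<and> \<not> B x u}"
  have fin: "finite S" "finite ?N" using assms finW finite_subset by auto
  have "?N - S = ?N - (S - {x})" by auto
  moreover have "card ?N - card (S - {x}) \<le> card (?N - (S - {x}))"
    using fin by (intro diff_card_le_card_Diff) auto
  moreover have "card (S - {x}) = card S - 1" "card S \<ge> 1"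
    using assms fin by (auto simp: Suc_le_eq card_gt_0_iff)
  ultimately have "card ?N \<le> card (?N - S) + (card S - 1)" "1 \<le> card S" by simp_all
  moreover have "n \<le> card ?N + 1" using red_deg assms by blast
  ultimately show ?thesis by linarith
qed

lemma extend_pendant:
  assumes g: "sgraph A1 E1" and f: "red_emb B A' (Restr E1 A') W f" and A: "A1 = insert v A'" "v \<notin> A'"
    and c: "card A1 \<le> n" and N: "E1 `` {v} \<inter> A' \<subseteq> {u}"
  shows "\<exists>f. red_emb B A1 E1 W f"
proof -
  have finA: "finite A'" "card A1 = Suc (card A')" using sgraphD(1)[OF g] A by auto
  have fW: "f ` A' \<subseteq> W" and cf: "card (f ` A') = card A'" using f by (auto simp: red_emb_def card_image)
  have "\<exists>y\<in>W. y \<notin> f ` A' \<and> (u \<in> A' \<longrightarrow> \<not> B (f u) y)"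
  proof (cases "u \<in> A'")
    case True
    then have "n \<le> card ({w\<in>W. w \<noteq> f u \<and> \<not> B (f u) w} - f ` A') + card A'"
      using free_red_nbrs[of "f u" "f ` A'"] fW cf by auto
    then have "card ({w\<in>W. w \<noteq> f u \<and> \<not> B (f u) w} - f ` A') > 0" using c finA by simp
    then have "{w\<in>W. w \<noteq> f u \<and> \<not> B (f u) w} - f ` A' \<noteq> {}" by fastforce
    then show ?thesis by blast
  next
    case False
    have "card (f ` A') < card W" using cf c finA cW n_ge by simp
    then have "\<not> W \<subseteq> f ` A'" using card_mono[of "f ` A'" W] finA(1) by fastforce
    then show ?thesis using False by blast
  qed
  then obtain y where y: "y \<in> W" "y \<notin> f ` A'" "u \<in> A' \<longrightarrow> \<not> B (f u) y" by blast
  have "red_emb B A1 E1 W (f(v := y))"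
    by (rule red_emb_extend[OF g f A y(1,2)]) (use N y(3) symB in blast)
  then show ?thesis by blast
qed

text \<open>The last hypothesis describes a forest in a form that passes to subgraphs; a vertex of
  degree at most one is put back last.\<close>

lemma embed_1_degenerate:
  assumes "sgraph A1 E1" "card A1 \<le> n"
    and "\<And>S. S \<subseteq> A1 \<Longrightarrow> S \<noteq> {} \<Longrightarrow> \<exists>v\<in>S. card (E1 `` {v} \<inter> S) \<le> 1"
  shows "\<exists>f. red_emb B A1 E1 W f"
  using assms
proof (induction "card A1" arbitrary: A1 E1)
  case 0
  then have "A1 = {}" "E1 = {}" using sgraphD(1,2)[OF 0(2)] by auto
  then show ?case by (auto simp: red_emb_def)
next
  case (Suc t)
  note g' = sgraphD[OF Suc.prems(1)]
  have "A1 \<noteq> {}" using Suc(2) by auto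
  then obtain v where v: "v \<in> A1" "card (E1 `` {v} \<inter> A1) \<le> 1" using Suc.prems(3)[of A1] by blast
  define A' where "A' = A1 - {v}"
  have A': "A1 = insert v A'" "v \<notin> A'" "card A' = t" using v g'(1) Suc(2) by (auto simp: A'_def)
  have "\<exists>f. red_emb B A' (Restr E1 A') W f"
  proof (rule Suc.hyps(1))
    show "sgraph A' (Restr E1 A')" using sgraph_restrict[OF Suc.prems(1)] A' by blast
    show "\<exists>v\<in>S. card (Restr E1 A' `` {v} \<inter> S) \<le> 1" if S: "S \<subseteq> A'" "S \<noteq> {}" for S
    proof -
      obtain x where x: "x \<in> S" "card (E1 `` {x} \<inter> S) \<le> 1" using Suc.prems(3)[of S] S A' by blast
      have "card (Restr E1 A' `` {x} \<inter> S) \<le> card (E1 `` {x} \<inter> S)"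
        using g'(8) by (intro card_mono) auto
      then show ?thesis using x le_trans by blast
    qed
  qed (use A' Suc in auto)
  then obtain f where f: "red_emb B A' (Restr E1 A') W f" ..
  obtain u where "E1 `` {v} \<inter> A' \<subseteq> {u}"
  proof -
    have "card (E1 `` {v} \<inter> A') \<le> 1"
      using v(2) card_mono[of "E1 `` {v} \<inter> A1" "E1 `` {v} \<inter> A'"] g'(8) A'(1) by fastforce
    then show thesis using that g'(8)
      by (metis card_1_singletonE card_0_eq empty_subsetI finite_Int le_Suc_eq le_zero_eq One_nat_def subset_refl)
  qed
  then show ?case using extend_pendant[OF Suc.prems(1) f A'(1,2) Suc.prems(2)] by blast
qed

lemma embed_suppressed:
  assumes g: "sgraph A1 E1" and c: "card A1 \<le> n"
    and vs: "distinct vs" "length vs = 5 * m" "set vs \<subseteq> twos A1 E1" "successively (\<lambda>x y. (x, y) \<in> E1) vs"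
    and vs_eq: "vs = v0 # v1 # v2 # rest"
    and f: "red_emb B (A1 - {v1}) (Restr E1 (A1 - {v1}) \<union> {(v0, v2), (v2, v0)}) W f"
  shows "\<exists>f. red_emb B A1 E1 W f"
proof -
  note g' = sgraphD[OF g]
  let ?R = "\<lambda>x y. \<not> B x y"
  define A' where "A' = A1 - {v1}"
  have vsA: "set vs \<subseteq> A1" using vs(3) by (auto simp: twos_def)
  define ws where "ws = v0 # v2 # rest"
  have ws: "set ws = set vs - {v1}" "distinct ws" "length ws = 5 * m - 1" "set ws \<subseteq> A'"
    using vs(1,2) vsA by (auto simp: ws_def vs_eq A'_def)
  have finj: "inj_on f A'" and fW: "f ` A' \<subseteq> W"
    and fE: "\<And>x y. (x, y) \<in> Restr E1 A' \<union> {(v0, v2), (v2, v0)} \<Longrightarrow> \<not> B (f x) (f y)"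
    using f unfolding red_emb_def A'_def by blast+
  have fred: "\<not> B (f v0) (f v2)" "\<And>x y. (x, y) \<in> E1 \<Longrightarrow> x \<noteq> v1 \<Longrightarrow> y \<noteq> v1 \<Longrightarrow> \<not> B (f x) (f y)"
    using fE g'(6,7) by (auto simp: A'_def)
  define xs where "xs = map f ws"
  have xs: "distinct xs" "length xs = 5 * m - 1" "set xs \<subseteq> W"
    using ws finj fW by (auto simp: xs_def distinct_map inj_on_subset)
  have xs_red: "successively ?R xs"
  proof -
    have "successively (\<lambda>x y. (x, y) \<in> E1) (v2 # rest)" using vs(4) vs_eq by (simp add: successively_Cons)
    moreover have "?R (f x) (f y)" if "x \<in> set (v2 # rest)" "y \<in> set (v2 # rest)" "(x, y) \<in> E1" for x y
      using fred(2)[OF that(3)] that vs(1) vs_eq by auto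
    ultimately have "successively (\<lambda>x y. ?R (f x) (f y)) (v2 # rest)"
      by (metis (mono_tags, lifting) successively_mono)
    then have "successively (\<lambda>x y. ?R (f x) (f y)) ws" using fred(1) by (simp add: ws_def)
    then show ?thesis unfolding xs_def successively_map .
  qed
  define Y where "Y = W - f ` A'"
  have v1: "v1 \<in> A1" using vsA vs_eq by auto
  have cA': "card A' + 1 = card A1" unfolding A'_def using card.remove[OF g'(1) v1] by simp
  have "card (f ` A') = card A'" using finj by (rule card_image)
  moreover have "card (f ` A') \<le> card W" using fW finW by (intro card_mono)
  moreover have "card Y = card W - card (f ` A')" unfolding Y_def using fW finW
    by (intro card_Diff_subset) (auto intro: finite_subset)
  ultimately have cY: "card Y + card A' = card W" by simp
  have YV: "Y \<subseteq> V" "Y \<inter> set xs = {}" using WV ws(4) by (auto simp: Y_def xs_def)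
  have "\<exists>zs. longer_path xs Y zs"
  proof (cases "\<exists>y1\<in>Y. \<exists>y2\<in>Y. B y1 y2")
    case True
    then obtain y1 y2 where "y1 \<in> Y" "y2 \<in> Y" "B y1 y2" by blast
    then show ?thesis
      using xs xs_red YV WV cY cA' c cW n_ge
      by (intro longer_path_of_blue_edge[of xs Y y1 y2]) auto
  next
    case False
    show ?thesis
    proof (cases "m = 1")
      case True
      have "card Y < n" by (rule no_red_clique) (use False YV in auto)
      then show ?thesis using cY cA' c W1[OF True] cV by simp
    next
      case m: False
      show ?thesis
        using xs xs_red YV WV cY cA' c cW False m m1
        by (intro longer_path_of_red_clique) auto
    qed
  qed
  then obtain zs where "longer_path xs Y zs" ..
  then have zs: "distinct zs" "length zs = 5 * m" "hd zs = f v0" "last zs = last xs"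
     "set zs \<subseteq> set xs \<union> Y" "successively ?R zs"
    using xs(2) m1 by (auto simp: longer_path_def xs_def ws_def)
  define h where "h v = (case map_of (zip vs zs) v of Some y \<Rightarrow> y | None \<Rightarrow> f v)" for v
  have hin: "h (vs ! i) = zs ! i" if "i < 5 * m" for i
    using that vs(1,2) zs(2) by (simp add: h_def map_of_zip_nth)
  have hout: "h v = f v" if "v \<notin> set vs" for v
    using that vs(2) zs(2) by (simp add: h_def map_of_zip_is_None[THEN iffD2])
  have "h v0 = f v0" using hin[of 0] vs_eq zs(2,3) m1 by (cases zs) auto
  have "last vs = last ws" using vs_eq by (simp add: ws_def)
  moreover have "last zs = f (last ws)" using zs(4) by (simp add: xs_def ws_def last_map)
  moreover have "h (last vs) = last zs"
  proof -
    have "vs \<noteq> []" "zs \<noteq> []" using vs(2) zs(2) m1 by auto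
    then show ?thesis using hin[of "5 * m - 1"] vs(2) zs(2) m1 by (simp add: last_conv_nth)
  qed
  ultimately have hlast: "h (last vs) = f (last vs)" by simp
  have hends: "h v = f v" if "v \<notin> set vs \<or> v = v0 \<or> v = last vs" for v
    using that hout hlast \<open>h v0 = f v0\<close> by blast
  have hvs: "h v \<in> set zs" if "v \<in> set vs" for v
    using that hin vs(2) zs(2) by (metis in_set_conv_nth nth_mem)
  have adj: "(vs ! i, vs ! Suc i) \<in> E1" if "Suc i < 5 * m" for i
    using vs(2,4) that by (auto simp: successively_conv_nth)
  have zred: "\<not> B (zs ! i) (zs ! Suc i)" if "Suc i < 5 * m" for i
    using zs(2,6) that by (auto simp: successively_conv_nth)
  have inner: "\<not> B (h u) (h w)" if u: "u \<in> set vs" "u \<noteq> v0" "u \<noteq> last vs" and uw: "(u, w) \<in> E1" for u w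
  proof -
    obtain i where i: "i < 5 * m" "u = vs ! i" using u vs(2) by (metis in_set_conv_nth)
    have "i \<noteq> 0" using i u(2) vs_eq by (cases i) auto
    moreover have "i \<noteq> 5 * m - 1" using i u(3) vs(2) vs_eq by (metis last_conv_nth list.distinct(1))
    ultimately have i': "Suc (i - 1) = i" "Suc i < 5 * m" using i by auto
    have "vs ! (i - 1) \<noteq> vs ! Suc i" using vs(1,2) i' by (simp add: nth_eq_iff_index_eq)
    moreover have "vs ! (i - 1) \<in> E1 `` {u}" "vs ! Suc i \<in> E1 `` {u}"
      using adj[of "i - 1"] adj[of i] i i' g'(3) by auto
    moreover have "card (E1 `` {u}) = 2" using u vs(3) by (auto simp: twos_def)
    ultimately have "E1 `` {u} = {vs ! (i - 1), vs ! Suc i}" using two_nbrs by metis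
    then consider "w = vs ! (i - 1)" | "w = vs ! Suc i" using uw by blast
    then show ?thesis
    proof cases
      case 1
      then show ?thesis using hin[of i] hin[of "i - 1"] zred[of "i - 1"] i i' symB by auto
    next
      case 2
      then show ?thesis using hin[of i] hin[of "Suc i"] zred[of i] i i' by auto
    qed
  qed
  have "red_emb B A1 E1 W h"
    unfolding red_emb_def
  proof (intro conjI)
    have fo: "f v \<notin> set zs" if "v \<in> A1" "v \<notin> set vs" for v
    proof -
      have "v \<in> A'" using that vs_eq by (auto simp: A'_def)
      then have "f v \<notin> Y" by (auto simp: Y_def)
      moreover have "f v \<notin> set xs"
        using that \<open>v \<in> A'\<close> ws finj by (auto simp: xs_def dest: inj_onD)
      ultimately show ?thesis using zs(5) by blast
    qed
    have outA': "v \<in> A1 \<Longrightarrow> v \<notin> set vs \<Longrightarrow> v \<in> A'" for v using vs_eq by (auto simp: A'_def)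
    show "inj_on h A1"
    proof (rule inj_onI)
      fix u v assume uv: "u \<in> A1" "v \<in> A1" "h u = h v"
      show "u = v"
      proof (cases "u \<in> set vs"; cases "v \<in> set vs")
        assume "u \<in> set vs" "v \<in> set vs"
        then obtain i j where "i < 5 * m" "u = vs ! i" "j < 5 * m" "v = vs ! j"
          using vs(2) by (metis in_set_conv_nth)
        then show ?thesis using uv(3) hin zs(1,2) by (simp add: nth_eq_iff_index_eq)
      next
        assume "u \<in> set vs" "v \<notin> set vs"
        then show ?thesis using uv hvs[of u] hout[of v] fo[of v] by auto
      next
        assume "u \<notin> set vs" "v \<in> set vs"
        then show ?thesis using uv hvs[of v] hout[of u] fo[of u] by auto
      next
        assume "u \<notin> set vs" "v \<notin> set vs"
        then show ?thesis using uv hout finj outA' by (metis inj_onD)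
      qed
    qed
    show "h ` A1 \<subseteq> W"
    proof
      fix y assume "y \<in> h ` A1"
      then obtain v where v: "v \<in> A1" "y = h v" by auto
      show "y \<in> W"
        using v hvs[of v] hout[of v] outA'[of v] fW zs(5) xs(3) by (cases "v \<in> set vs") (auto simp: Y_def)
    qed
    have "\<not> B (h u) (h w)" if uw: "(u, w) \<in> E1" for u w
    proof -
      consider "u \<in> set vs" "u \<noteq> v0" "u \<noteq> last vs" | "w \<in> set vs" "w \<noteq> v0" "w \<noteq> last vs"
        | "u \<notin> set vs \<or> u = v0 \<or> u = last vs" "w \<notin> set vs \<or> w = v0 \<or> w = last vs" by blast
      then show ?thesis
      proof cases
        case 1 then show ?thesis using inner uw by blast
      next
        case 2 then show ?thesis using inner g'(3)[OF uw] symB by blast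
      next
        case 3
        have "v1 \<in> set vs" "v1 \<noteq> v0" "v1 \<noteq> last vs" using vs(1) vs_eq by auto
        then have "u \<noteq> v1" "w \<noteq> v1" using 3 by auto
        then show ?thesis using fred(2)[OF uw] hends[OF 3(1)] hends[OF 3(2)] by simp
      qed
    qed
    then show "\<forall>(u, w)\<in>E1. \<not> B (h u) (h w)" by auto
  qed
  then show ?thesis by blast
qed

text \<open>
  A vertex of large blue degree yields a red clique among its neighbours; otherwise vertices of
  minimum degree can be added greedily.
\<close>

lemma embed_few_arcs:
  assumes "sgraph A1 E1" "card A1 + (2 * m - 1) * card E1 \<le> card W"
  shows "\<exists>f. red_emb B A1 E1 W f"
  using assms
proof (induction "card A1" arbitrary: A1 E1)
  case 0
  then have "A1 = {}" "E1 = {}" using sgraphD(1,2)[OF 0(2)] by auto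
  then show ?case by (auto simp: red_emb_def)
next
  case (Suc t)
  note g' = sgraphD[OF Suc.prems(1)]
  show ?case
  proof (cases "\<exists>x\<in>W. (2 * m - 1) * t + 1 \<le> card {u\<in>W. B x u}")
    case True
    then obtain x where x: "x \<in> W" "(2 * m - 1) * (Suc t - 1) + 1 \<le> card {u\<in>W. B x u}" by auto
    then obtain K where K: "K \<subseteq> {u\<in>W. B x u}" "card K = Suc t" "\<forall>u\<in>K. \<forall>v\<in>K. \<not> B u v"
      using red_clique_in_nbhd[of x "{u\<in>W. B x u}" "Suc t"] WV by blast
    then have "finite K" using finW by (auto intro: finite_subset)
    then obtain f where "f ` A1 \<subseteq> K" "inj_on f A1" using card_le_inj[OF g'(1) \<open>finite K\<close>] Suc(2) K(2) by auto
    then have "red_emb B A1 E1 W f"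
      by (rule red_emb_into_clique) (use K g'(2) in auto)
    then show ?thesis by blast
  next
    case False
    then have low: "card {u\<in>W. B x u} \<le> (2 * m - 1) * t" if "x \<in> W" for x using that by fastforce
    have "A1 \<noteq> {}" using Suc(2) by auto
    \<comment> \<open>The minimum degree times \<open>card A1\<close> is at most
      \<open>card E1\<close>, so \<open>\<delta>\<close> blue neighbourhoods of at most
      \<open>(2 m - 1) * t\<close> vertices stay within the budget
      \<open>(2 m - 1) * card E1\<close>.\<close>
    define \<delta> where "\<delta> = Min ((\<lambda>v. card (E1 `` {v})) ` A1)"
    have "\<delta> \<in> (\<lambda>v. card (E1 `` {v})) ` A1" unfolding \<delta>_def using \<open>A1 \<noteq> {}\<close> g'(1) by (intro Min_in) auto
    then obtain v where v: "v \<in> A1" "card (E1 `` {v}) = \<delta>" by auto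
    have "\<delta> \<le> card (E1 `` {u})" if "u \<in> A1" for u unfolding \<delta>_def using that g'(1) by (intro Min_le) auto
    then have "card A1 * \<delta> \<le> card E1"
      unfolding card_arcs[OF Suc.prems(1)] using sum_bounded_below[of A1 \<delta> "\<lambda>v. card (E1 `` {v})"] by simp
    then have "(2 * m - 1) * (Suc t * \<delta>) \<le> (2 * m - 1) * card E1" using Suc(2) by simp
    then have room: "Suc t + (2 * m - 1) * (Suc t * \<delta>) \<le> card W" using Suc.prems(2) Suc(2) by linarith
    define A' where "A' = A1 - {v}"
    have A': "A1 = insert v A'" "v \<notin> A'" "card A' = t" using v g'(1) Suc(2) by (auto simp: A'_def)
    have "card (Restr E1 A') \<le> card E1" using g'(5) by (intro card_mono) auto
    then have "(2 * m - 1) * card (Restr E1 A') \<le> (2 * m - 1) * card E1" by simp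
    then have "card A' + (2 * m - 1) * card (Restr E1 A') \<le> card W" using Suc.prems(2) A'(3) Suc(2) by linarith
    then obtain f where f: "red_emb B A' (Restr E1 A') W f"
      using Suc.hyps(1)[of A' "Restr E1 A'"] sgraph_restrict[OF Suc.prems(1), of A'] A' by auto
    let ?U = "\<Union>u\<in>E1 `` {v}. {w\<in>W. B (f u) w}"
    have EA: "E1 `` {v} \<subseteq> A'" using g' by (auto simp: A'_def)
    have "card ?U \<le> (\<Sum>u\<in>E1 `` {v}. card {w\<in>W. B (f u) w})" by (rule card_UN_le[OF g'(8)])
    also have "\<dots> \<le> card (E1 `` {v}) * ((2 * m - 1) * t)"
      using sum_bounded_above[of "E1 `` {v}" "\<lambda>u. card {w\<in>W. B (f u) w}" "(2 * m - 1) * t"] low EA f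
      by (force simp: red_emb_def)
    also have "\<dots> = (2 * m - 1) * (t * \<delta>)" unfolding v(2) by (simp only: mult.commute mult.left_commute)
    also have "\<dots> \<le> (2 * m - 1) * (Suc t * \<delta>)" by (intro mult_le_mono) simp_all
    finally have U: "card ?U \<le> (2 * m - 1) * (Suc t * \<delta>)" .
    have "card (f ` A') \<le> t" using card_image_le[of A' f] A' g'(1) by simp
    then have "card (f ` A' \<union> ?U) < card W"
      using card_Un_le[of "f ` A'" ?U] U room by linarith
    moreover have "finite (f ` A' \<union> ?U)" using A' g'(1,8) finW by auto
    ultimately have "\<not> W \<subseteq> f ` A' \<union> ?U" using card_mono by (metis not_less)
    then obtain y where y: "y \<in> W" "y \<notin> f ` A'" "y \<notin> ?U" by blast
    have "red_emb B A1 E1 W (f(v := y))"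
      by (rule red_emb_extend[OF Suc.prems(1) f A'(1,2) y(1,2)]) (use y symB in blast)
    then show ?thesis by blast
  qed
qed

section \<open>Short cycles and the complete embedding\<close>

text \<open>A blue edge inside \<open>X\<close> would be closed to a cycle by an alternating path
  through \<open>m + 1\<close> vertices of \<open>X\<close> and \<open>m\<close> of
  \<open>X'\<close>. The two sets may overlap, so the latter are taken outside the former.\<close>

lemma red_edge_between:
  assumes X: "X \<subseteq> W" "X' \<subseteq> W" "5 * m \<le> card X" "5 * m \<le> card X'"
    and no: "\<And>x x'. x \<in> X \<Longrightarrow> x' \<in> X' \<Longrightarrow> x \<noteq> x' \<Longrightarrow> B x x'"
  shows "\<And>a b. a \<in> X \<Longrightarrow> b \<in> X \<Longrightarrow> \<not> B a b"
proof
  fix a b assume ab: "a \<in> X" "b \<in> X" "B a b"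
  then have "b \<noteq> a" using irrB by auto
  have fin: "finite X" "finite X'" using X finW finite_subset by auto
  obtain ls where ls: "distinct ls" "set ls \<subseteq> X" "length ls = m + 1" "hd ls = b" "last ls = a"
    by (rule list_with_ends[OF fin(1) ab(2,1) \<open>b \<noteq> a\<close>, of "m + 1"]) (use m1 X(3) in auto)
  define U where "U = X' - set ls"
  have "card X' - card (set ls) \<le> card U" unfolding U_def by (rule diff_card_le_card_Diff) simp
  then have "m \<le> card U" using X(4) ls(3) card_length[of ls] m1 by linarith
  moreover have "B x w" if "x \<in> set ls" "w \<in> U" for x w
    using that ls(2) by (intro no) (auto simp: U_def)
  then have "{w\<in>U. B x w \<and> B w y} = U" if "x \<in> set ls" "y \<in> set ls" for x y
    using that symB by blast
  ultimately have "chain B U m ls" by (intro chain_const[OF ls(1)]) auto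
  then have "\<not> B (last ls) (hd ls)"
    by (rule chain_ends_nonadjacent) (use ls X WV in \<open>auto simp: U_def\<close>)
  then show False using ls ab by simp
qed

text \<open>Such a graph is a cycle. Two adjacent vertices are removed and the remaining path is
  embedded. If the two cannot be put back on a red edge, the free red neighbours of
  \<open>f u\<close> form a red clique that holds the whole cycle.\<close>

lemma embed_short_cycle:
  assumes g: "sgraph A1 E1" and cn: "connected_on A1 E1" and ne: "A1 \<noteq> {}"
    and two: "twos A1 E1 = A1" and c: "card A1 \<le> 5 * m - 1"
  shows "\<exists>f. red_emb B A1 E1 W f"
proof -
  note g' = sgraphD[OF g]
  have deg: "card (E1 `` {x}) = 2" if "x \<in> A1" for x using that two by (auto simp: twos_def)
  obtain v where v: "v \<in> A1" using ne by auto
  obtain v' u where vu: "E1 `` {v} = {v', u}" "v' \<noteq> u" using deg[OF v] by (auto simp: card_2_iff)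
  have v': "v' \<in> A1" "u \<in> A1" "v \<noteq> v'" "v \<noteq> u" "(v', v) \<in> E1"
    using vu(1) g' by blast+
  have "v \<in> E1 `` {v'}" using v' by auto
  obtain u' where u': "E1 `` {v'} = {v, u'}" "u' \<noteq> v"
  proof -
    obtain a b where ab: "E1 `` {v'} = {a, b}" "a \<noteq> b" using deg[OF v'(1)] by (auto simp: card_2_iff)
    then show thesis using that[of a] that[of b] \<open>v \<in> E1 `` {v'}\<close> by (cases "v = a") auto
  qed
  have "u' \<in> A1" "u' \<noteq> v'" using u'(1) g' by blast+
  define A2 where "A2 = A1 - {v, v'}"
  have A2: "u \<in> A2" "u' \<in> A2" "A2 \<subseteq> A1" using v' vu u' \<open>u' \<in> A1\<close> \<open>u' \<noteq> v'\<close> by (auto simp: A2_def)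
  have cA2: "card A2 + 2 = card A1"
  proof -
    have "card A2 = card A1 - card {v, v'}" unfolding A2_def using v v' by (intro card_Diff_subset) auto
    moreover have "card {v, v'} \<le> card A1" using v v' g'(1) by (intro card_mono) auto
    ultimately show ?thesis using v'(3) by simp
  qed
  have "\<exists>f. red_emb B A2 (Restr E1 A2) W f"
  proof (rule embed_1_degenerate[OF sgraph_restrict[OF g A2(3)]])
    show "card A2 \<le> n" using cA2 c n_ge by linarith
    \<comment> \<open>An arc leaves \<open>S\<close>, so one of the two neighbours of its start lies
      outside \<open>S\<close>.\<close>
    fix S assume S: "S \<subseteq> A2" "S \<noteq> {}"
    then have "S \<subseteq> A1" "S \<noteq> A1" using v by (auto simp: A2_def)
    then obtain x y where xy: "x \<in> S" "y \<in> A1 - S" "(x, y) \<in> E1"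
      using cn S(2) unfolding connected_on_def by blast
    have "card (Restr E1 A2 `` {x} \<inter> S) \<le> card (E1 `` {x} - {y})"
      using xy g'(8) by (intro card_mono) auto
    also have "\<dots> = 1" using xy deg[of x] \<open>S \<subseteq> A1\<close> g'(8) by (simp add: subset_iff)
    finally show "\<exists>x\<in>S. card (Restr E1 A2 `` {x} \<inter> S) \<le> 1" using xy(1) by blast
  qed
  then obtain f where f: "red_emb B A2 (Restr E1 A2) W f" ..
  then have fW: "f ` A2 \<subseteq> W" "card (f ` A2) = card A2" by (auto simp: red_emb_def card_image)
  define X where "X = {w\<in>W. w \<noteq> f u \<and> \<not> B (f u) w} - f ` A2"
  define X' where "X' = {w\<in>W. w \<noteq> f u' \<and> \<not> B (f u') w} - f ` A2"
  have cX: "5 * m \<le> card X" "5 * m \<le> card X'"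
    unfolding X_def X'_def using free_red_nbrs[of "f u" "f ` A2"] free_red_nbrs[of "f u'" "f ` A2"] fW A2 cA2 c n_ge
    by auto
  have XW: "X \<subseteq> W" "X' \<subseteq> W" by (auto simp: X_def X'_def)
  show ?thesis
  proof (cases "\<exists>x\<in>X. \<exists>x'\<in>X'. x \<noteq> x' \<and> \<not> B x x'")
    case True
    then obtain x x' where x: "x \<in> X" "x' \<in> X'" "x \<noteq> x'" "\<not> B x x'" by blast
    define A3 where "A3 = insert v A2"
    have A3: "A1 = insert v' A3" "v' \<notin> A3" "v \<notin> A2" "A3 \<subseteq> A1" using v v' by (auto simp: A3_def A2_def)
    have R: "Restr (Restr E1 A3) A2 = Restr E1 A2" by (auto simp: A3_def)
    have "red_emb B A3 (Restr E1 A3) W (f(v := x))"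
    proof (rule red_emb_extend[of A3 "Restr E1 A3" B A2 W f v x])
      show "sgraph A3 (Restr E1 A3)" by (rule sgraph_restrict[OF g A3(4)])
      show "red_emb B A2 (Restr (Restr E1 A3) A2) W f" unfolding R by (rule f)
      show "\<not> B (f b) x \<and> \<not> B x (f b)" if "b \<in> A2" "(v, b) \<in> Restr E1 A3" for b
      proof -
        have "b = u" using that vu(1) by (auto simp: A2_def)
        then show ?thesis using x(1) symB by (auto simp: X_def)
      qed
    qed (use A3 x in \<open>auto simp: A3_def X_def\<close>)
    then have "red_emb B A1 E1 W ((f(v := x))(v' := x'))"
    proof (rule red_emb_extend[OF g _ A3(1,2)])
      show "x' \<notin> (f(v := x)) ` A3" using x A3(3) by (auto simp: A3_def X'_def)
      show "\<not> B ((f(v := x)) b) x' \<and> \<not> B x' ((f(v := x)) b)" if "b \<in> A3" "(v', b) \<in> E1" for b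
      proof -
        have "b = v \<or> b = u'" using that u'(1) by auto
        then show ?thesis using x u'(2) symB by (auto simp: X'_def)
      qed
    qed (use x in \<open>auto simp: X'_def\<close>)
    then show ?thesis by blast
  next
    case False
    then have red: "\<not> B a b" if "a \<in> X" "b \<in> X" for a b
      using red_edge_between[OF XW cX] that by blast
    have "finite X" using XW finW finite_subset by blast
    moreover have "card A1 \<le> card X" using c cX by linarith
    ultimately obtain h where "h ` A1 \<subseteq> X" "inj_on h A1" using card_le_inj[OF g'(1)] by blast
    then have "red_emb B A1 E1 W h"
      by (rule red_emb_into_clique) (use red XW g'(2) in auto)
    then show ?thesis by blast
  qed
qed

text \<open>Both reductions preserve the bound on \<open>card E1\<close> and can be undone in the
  host. The irreducible graphs are a single vertex, a cycle on fewer than \<open>5 m\<close>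
  vertices, and graphs with so few arcs that \<open>embed_few_arcs\<close> applies.\<close>

lemma embed_connected:
  assumes "sgraph A1 E1" "connected_on A1 E1" "A1 \<noteq> {}" "card A1 \<le> n" "card E1 \<le> 2 * card A1 + 2 * l"
  shows "\<exists>f. red_emb B A1 E1 W f"
  using assms
proof (induction "card A1" arbitrary: A1 E1)
  case 0
  then show ?case using sgraphD(1)[OF 0(2)] by simp
next
  case (Suc t)
  note g = Suc.prems(1) and cn = Suc.prems(2)
  note g' = sgraphD[OF g]
  consider (single) "t = 0" | (leaf) v where "t > 0" "v \<in> A1" "card (E1 `` {v}) = 1"
    | (core) "\<And>v. v \<in> A1 \<Longrightarrow> 2 \<le> card (E1 `` {v})"
  proof (cases "t > 0 \<and> (\<forall>v\<in>A1. card (E1 `` {v}) \<noteq> 1)")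
    case True
    then show ?thesis using degree_pos[OF g cn] Suc(2) core by (metis One_nat_def Suc_leI le_antisym not_less_eq_eq numeral_2_eq_2)
  qed (use single leaf in auto)
  then show ?case
  proof cases
    case single
    then obtain a where a: "A1 = {a}" using Suc(2) by (metis card_1_singletonE One_nat_def)
    then have "E1 = {}" using g' by auto
    then show ?thesis
      by (intro embed_1_degenerate[OF g Suc.prems(4)]) auto
  next
    case leaf
    obtain u where u: "E1 `` {v} = {u}" using leaf(3) by (auto simp: card_1_singleton_iff)
    note rl = remove_leaf[OF g cn leaf(2) u]
    have "\<exists>f. red_emb B (A1 - {v}) (Restr E1 (A1 - {v})) W f"
      by (rule Suc.hyps(1)[OF _ rl(1,2)]) (use rl Suc.prems Suc(2) in auto)
    then obtain f where "red_emb B (A1 - {v}) (Restr E1 (A1 - {v})) W f" ..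
    then show ?thesis
      by (rule extend_pendant[OF g _ _ _ Suc.prems(4), where u = u]) (use leaf u in auto)
  next
    case core
    let ?D = "twos A1 E1"
    show ?thesis
    proof (cases "\<exists>v\<in>?D. card ((Restr E1 ?D)\<^sup>* `` {v}) > 5 * m - 1")
      case True
      then obtain v where v: "v \<in> ?D" "card ((Restr E1 ?D)\<^sup>* `` {v}) > 5 * m - 1" by blast
      obtain vs where vs: "distinct vs" "length vs = Suc (5 * m - 1)" "set vs \<subseteq> ?D"
        "successively (\<lambda>x y. (x, y) \<in> E1) vs"
        by (rule twos_class_path[OF g v])
      have len: "length vs = 5 * m" using vs(2) m1 by simp
      \<comment> \<open>The fourth vertex shows that \<open>v2\<close> has neighbours
        \<open>v1\<close> and \<open>v3\<close> only, so \<open>v0\<close> and \<open>v2\<close> are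
        not adjacent and suppressing \<open>v1\<close> leaves a simple graph.\<close>
      obtain v0 v1 v2 v3 rest where eq: "vs = v0 # v1 # v2 # v3 # rest"
      proof -
        have "4 \<le> length vs" using len m1 by simp
        then show thesis using that
          by (auto simp: Suc_le_length_iff numeral_eq_Suc)
      qed
      have tw: "E1 `` {x} = {a, b}" if "x \<in> set vs" "(x, a) \<in> E1" "(x, b) \<in> E1" "a \<noteq> b" for x a b
        using two_nbrs[of "E1 `` {x}" a b] that vs(3) by (auto simp: twos_def)
      have arcs: "(v0, v1) \<in> E1" "(v1, v2) \<in> E1" "(v2, v3) \<in> E1" using vs(4) eq by auto
      have N1: "E1 `` {v1} = {v0, v2}" using tw[of v1 v0 v2] arcs g'(3) vs(1) eq by auto
      have "E1 `` {v2} = {v1, v3}" using tw[of v2 v1 v3] arcs g'(3) vs(1) eq by auto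
      then have "v0 \<notin> E1 `` {v2}" using vs(1) eq by auto
      then have n02: "(v0, v2) \<notin> E1" using g'(3) by auto
      have v1A: "v1 \<in> A1" using arcs g' by auto
      have v02: "v0 \<noteq> v2" using vs(1) eq by auto
      note sp = suppress[OF g cn v1A N1 v02 n02]
      have "\<exists>f. red_emb B (A1 - {v1}) (Restr E1 (A1 - {v1}) \<union> {(v0, v2), (v2, v0)}) W f"
      proof (rule Suc.hyps(1)[OF _ sp(1,2)])
        show "A1 - {v1} \<noteq> {}" using sp(4) v02 N1 arcs g' by auto
      qed (use sp(3,4) Suc.prems Suc(2) in auto)
      then obtain f where f: "red_emb B (A1 - {v1}) (Restr E1 (A1 - {v1}) \<union> {(v0, v2), (v2, v0)}) W f" ..
      show ?thesis by (rule embed_suppressed[OF g Suc.prems(4) vs(1) len vs(3,4) eq f])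
    next
      case False
      then have cls: "card ((Restr E1 ?D)\<^sup>* `` {v}) \<le> 5 * m - 1" if "v \<in> ?D" for v using that by fastforce
      show ?thesis
      proof (cases "?D = A1")
        case True
        obtain v where v: "v \<in> A1" using Suc.prems(3) by auto
        have "Restr E1 ?D = E1" using True g' by auto
        moreover have "E1\<^sup>* `` {v} = A1"
        proof (rule closed_is_all[OF cn])
          show "E1\<^sup>* `` {v} \<subseteq> A1"
          proof
            fix w assume "w \<in> E1\<^sup>* `` {v}"
            then have "(v, w) \<in> E1\<^sup>*" by auto
            then show "w \<in> A1" by induction (use v g' in auto)
          qed
        qed (auto intro: rtrancl_into_rtrancl)
        ultimately have "card A1 \<le> 5 * m - 1" using cls[of v] v True by simp
        then show ?thesis by (rule embed_short_cycle[OF g cn Suc.prems(3) True])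
      next
        case ne: False
        \<comment> \<open>The bound equals \<open>30 m l - 4 l\<close>, hence there are at most
          \<open>60 m l\<close> arcs, and \<open>30 m l + 120 m^2 l\<close> is within the room given
          by \<open>l_bounds\<close>.\<close>
        have c1: "card A1 \<le> 2 * l + 6 * l * (5 * m - 1)"
          by (rule card_leafless[OF g cn core Suc.prems(5) cls ne])
        show ?thesis
        proof (rule embed_few_arcs[OF g])
          have "6 * l * (5 * m - 1) + 6 * l = 30 * (m * l)"
            using m1 by (cases m) (auto simp: algebra_simps)
          then have a: "card A1 + 4 * l \<le> 30 * (m * l)" using c1 by linarith
          then have "card E1 \<le> 60 * (m * l)" using Suc.prems(5) by linarith
          then have "(2 * m - 1) * card E1 \<le> (2 * m - 1) * (60 * (m * l))" by simp
          also have "\<dots> \<le> 120 * (m * m * l)" by (simp add: algebra_simps diff_mult_distrib)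
          finally have "card A1 + (2 * m - 1) * card E1 \<le> 144 * (m * m * l) + 144 * (m * l)"
            using a by linarith
          also have "\<dots> \<le> n" using l_bounds(1) by (simp add: mult.assoc)
          also have "n \<le> card W" using cW n_ge by linarith
          finally show "card A1 + (2 * m - 1) * card E1 \<le> card W" .
        qed
      qed
    qed
  qed
qed

lemma no_dense_host: False
proof -
  have "A \<noteq> {}" using cA n_ge by auto
  then obtain f where "red_emb B A E W f"
    using embed_connected[OF G conn] cA cE by auto
  then show False using no_emb red_emb_mono WV by blast
qed

end

section \<open>The Ramsey number\<close>

context counterexample
begin

lemma low_red_degree:
  assumes "W \<subseteq> V" "2 * n \<le> card W + 3 * m" "m = 1 \<Longrightarrow> W = V"
  shows "\<exists>x\<in>W. card {u\<in>W. u \<noteq> x \<and> \<not> B x u} + 1 < n"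
proof (rule ccontr)
  assume "\<not> ?thesis"
  then have *: "n \<le> card {u\<in>W. u \<noteq> x \<and> \<not> B x u} + 1" if "x \<in> W" for x
    using that by (meson not_less)
  interpret dense_host V B m A E n l W
    by unfold_locales (use assms * in auto)
  show False by (rule no_dense_host)
qed

lemma blue_degree:
  assumes "W \<subseteq> V" "x \<in> W"
  shows "card W = Suc (card {u\<in>W. u \<noteq> x \<and> \<not> B x u} + card {u\<in>W. B x u})"
proof -
  have "finite W" using assms finite_sub by simp
  have "W = insert x ({u\<in>W. u \<noteq> x \<and> \<not> B x u} \<union> {u\<in>W. B x u})" using assms by auto
  moreover have "finite ({u\<in>W. u \<noteq> x \<and> \<not> B x u} \<union> {u\<in>W. B x u})"
    "x \<notin> {u\<in>W. u \<noteq> x \<and> \<not> B x u} \<union> {u\<in>W. B x u}"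
    using \<open>finite W\<close> irrB by auto
  ultimately have "card W = Suc (card ({u\<in>W. u \<noteq> x \<and> \<not> B x u} \<union> {u\<in>W. B x u}))"
    using card_insert_disjoint by metis
  also have "card ({u\<in>W. u \<noteq> x \<and> \<not> B x u} \<union> {u\<in>W. B x u}) =
      card {u\<in>W. u \<noteq> x \<and> \<not> B x u} + card {u\<in>W. B x u}"
    using \<open>finite W\<close> by (intro card_Un_disjoint) auto
  finally show ?thesis .
qed

text \<open>The new vertex has at most \<open>n - 2\<close> red neighbours among
  \<open>2 n - 1 - j\<close> remaining vertices, hence at least \<open>n - j\<close> blue ones.
  Degrees are counted outside \<open>Q\<close>, so an earlier vertex loses at most the new one,
  which the growing \<open>j\<close> absorbs.\<close>

lemma peel_off:
  assumes "m \<ge> 2" "j \<le> 3 * m"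
  shows "\<exists>Q\<subseteq>V. card Q = j \<and> (\<forall>q\<in>Q. n + 1 \<le> card {w\<in>V - Q. B q w} + j)"
  using assms(2)
proof (induction j)
  case 0
  then show ?case by (intro exI[of _ "{}"]) auto
next
  case (Suc j)
  then obtain Q where Q: "Q \<subseteq> V" "card Q = j" "\<And>q. q \<in> Q \<Longrightarrow> n + 1 \<le> card {w\<in>V - Q. B q w} + j"
    by auto
  have finQ: "finite Q" using Q(1) finite_sub by auto
  have cW: "card (V - Q) = 2 * n - 1 - j" using Q cV finQ by (simp add: card_Diff_subset)
  have "2 * n \<le> card (V - Q) + 3 * m" using cW Suc.prems n_ge by linarith
  then obtain x where x: "x \<in> V - Q" "card {u\<in>V - Q. u \<noteq> x \<and> \<not> B x u} + 1 < n"
    using low_red_degree[of "V - Q"] assms(1) by auto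
  have bx: "n \<le> card {u\<in>V - Q. B x u} + j"
    using blue_degree[of "V - Q" x] x cW n_ge by auto
  have sub: "card {w\<in>V - Q. B q w} \<le> Suc (card {w\<in>V - insert x Q. B q w})" for q
  proof -
    have "{w\<in>V - Q. B q w} \<subseteq> insert x {w\<in>V - insert x Q. B q w}" by auto
    then have "card {w\<in>V - Q. B q w} \<le> card (insert x {w\<in>V - insert x Q. B q w})"
      using finV by (intro card_mono) auto
    moreover have "finite {w\<in>V - insert x Q. B q w}" using finV by simp
    ultimately show ?thesis by (simp add: card_insert_if split: if_splits)
  qed
  have "{u\<in>V - Q. B x u} = {u\<in>V - insert x Q. B x u}" using irrB by auto
  then have "n + 1 \<le> card {w\<in>V - insert x Q. B x w} + Suc j" using bx by simp
  moreover have "n + 1 \<le> card {w\<in>V - insert x Q. B q w} + Suc j" if "q \<in> Q" for q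
    using sub[of q] Q(3)[OF that] by linarith
  ultimately have "\<forall>q\<in>insert x Q. n + 1 \<le> card {w\<in>V - insert x Q. B q w} + Suc j" by blast
  moreover have "insert x Q \<subseteq> V" "card (insert x Q) = Suc j" using x(1) Q(1,2) finQ by auto
  ultimately show ?case by blast
qed

lemma no_counterexample: False
proof (cases "m = 1")
  case False
  then have m2: "m \<ge> 2" using m1 by simp
  then show False using peel_off[OF m2 order_refl] no_high_blue_set[OF m2] by blast
next
  case True
  \<comment> \<open>For triangles one vertex is enough: its blue neighbourhood has at least
    \<open>n\<close> vertices and no blue edge.\<close>
  have "2 * n \<le> card V + 3 * m" using cV n_ge m1 by linarith
  then obtain x where x: "x \<in> V" "card {u\<in>V. u \<noteq> x \<and> \<not> B x u} + 1 < n"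
    using low_red_degree[of V] by auto
  have "n \<le> card {u\<in>V. B x u}" using blue_degree[OF order_refl x(1)] x(2) cV by simp
  moreover have "card {u\<in>V. B x u} < n"
  proof (rule no_red_clique)
    fix a b assume ab: "a \<in> {u\<in>V. B x u}" "b \<in> {u\<in>V. B x u}" "a \<noteq> b"
    show "\<not> B a b"
    proof
      assume "B a b"
      then show False
        using nocyc[of "[x, a, b]"] ab x(1) True irrB symB by auto
    qed
  qed auto
  ultimately show False by simp
qed

end

section \<open>Translation to pair graphs and the Ramsey number\<close>

lemma card_parcs:
  assumes "pair_graph G"
  shows "card (parcs G) = 2 * card (edges G)"
proof -
  interpret pair_graph G by fact
  let ?e = "\<lambda>(u, v). {u, v}"
  have fin: "finite (parcs G)" by (rule pair_finite_arcs)
  have eq: "?e ` parcs G = edges G" by (auto simp: edges_def)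
  have "card {a\<in>parcs G. ?e a = e} = 2" if "e \<in> ?e ` parcs G" for e
  proof -
    from that obtain u v where uv: "(u, v) \<in> parcs G" "e = {u, v}" by auto
    then have "u \<noteq> v" "(v, u) \<in> parcs G" by (auto dest: no_loops intro: arcs_symmetric)
    then have "{a\<in>parcs G. ?e a = e} = {(u, v), (v, u)}" using uv by (auto simp: doubleton_eq_iff)
    then show ?thesis using \<open>u \<noteq> v\<close> by simp
  qed
  then have "(\<Sum>e\<in>?e ` parcs G. \<Sum>a\<in>{a\<in>parcs G. ?e a = e}. 1) = 2 * card (?e ` parcs G)" by simp
  then show ?thesis using sum.image_gen[OF fin, of "\<lambda>_. 1::nat" ?e] eq by simp
qed

lemma sgraph_of_pair_graph:
  assumes "pair_graph G" shows "sgraph (pverts G) (parcs G)"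
proof -
  interpret pair_graph G by fact
  show ?thesis
    unfolding sgraph_def
  proof (intro conjI)
    show "parcs G \<subseteq> pverts G \<times> pverts G" using in_arcsD1 in_arcsD2 by auto
    show "sym (parcs G)" using arcs_symmetric by (auto intro!: symI)
    show "irrefl (parcs G)" by (auto simp: irrefl_def dest: no_loops)
  qed (rule pair_finite_verts)
qed

lemma connected_on_of_connected:
  assumes "pair_graph G" "Digraph_Component.connected (with_proj G)"
  shows "connected_on (pverts G) (parcs G)"
  unfolding connected_on_def
proof (intro allI impI)
  fix S assume S: "S \<subseteq> pverts G" "S \<noteq> {}" "S \<noteq> pverts G"
  note g = sgraphD[OF sgraph_of_pair_graph[OF assms(1)]]
  obtain u w where uw: "u \<in> S" "w \<in> pverts G" "w \<notin> S" using S by blast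
  then have "(u, w) \<in> rtrancl_on (pverts G) ((parcs G)\<^sup>s)"
    using assms(2) S(1) unfolding connected_conv by auto
  moreover have "(parcs G)\<^sup>s = parcs G" using g(3) by (auto simp: symcl_def)
  ultimately have reach: "(u, w) \<in> rtrancl_on (pverts G) (parcs G)" by simp
  show "\<exists>u\<in>S. \<exists>v\<in>pverts G - S. (u, v) \<in> parcs G"
  proof (rule ccontr)
    assume "\<not> ?thesis"
    then have closed: "y \<in> S" if "x \<in> S" "(x, y) \<in> parcs G" "y \<in> pverts G" for x y using that by blast
    from reach have "w \<in> S" by (induction rule: rtrancl_on_induct) (use uw closed in auto)
    then show False using uw by simp
  qed
qed

lemma contains_cycleI:
  assumes "pair_graph \<Gamma>" "k \<ge> 3" "set cs \<subseteq> pverts \<Gamma>" "distinct cs" "length cs = k"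
    "successively (\<lambda>x y. (x, y) \<in> parcs \<Gamma>) cs" "(last cs, hd cs) \<in> parcs \<Gamma>"
  shows "contains_subgraph \<Gamma> (cycle_graph k)"
  unfolding contains_subgraph_iff[OF assms(1) pair_graph_cycle[OF assms(2)]]
proof (intro exI conjI)
  note g = sgraphD[OF sgraph_of_pair_graph[OF assms(1)]]
  show "inj_on (\<lambda>i. cs ! i) (pverts (cycle_graph k))"
    using assms(4,5) by (auto intro!: inj_onI simp: cycle_graph_def nth_eq_iff_index_eq)
  show "(\<lambda>i. cs ! i) ` pverts (cycle_graph k) \<subseteq> pverts \<Gamma>"
    using assms(3,5) by (auto simp: cycle_graph_def)
  have "cs \<noteq> []" using assms(2,5) by auto
  have *: "(cs ! i, cs ! ((i + 1) mod k)) \<in> parcs \<Gamma>" if "i < k" for i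
  proof (cases "Suc i = k")
    case True
    then have "cs ! i = last cs" using assms(5) \<open>cs \<noteq> []\<close> by (metis diff_Suc_1 last_conv_nth)
    then show ?thesis using True assms(7) \<open>cs \<noteq> []\<close> by (simp add: hd_conv_nth)
  next
    case False
    then show ?thesis using that assms(5,6) by (simp add: successively_conv_nth)
  qed
  show "\<forall>(i, j)\<in>parcs (cycle_graph k). (cs ! i, cs ! j) \<in> parcs \<Gamma>"
    using * g(3) by (auto simp: cycle_graph_def)
qed

lemma ramsey_upper:
  fixes G :: "'a pair_pre_digraph" and \<Gamma> :: "'b pair_pre_digraph"
  assumes k: "k \<ge> 3" "odd k" and n: "n \<ge> 7 * k - 4"
    and G: "pair_graph G" "Digraph_Component.connected (with_proj G)" "card (pverts G) = n"
    and e: "real (card (edges G)) \<le> (1 + 1 / (36 * (real k)\<^sup>2)) * real n"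
    and \<Gamma>: "pair_graph \<Gamma>" "card (pverts \<Gamma>) = 2 * n - 1"
  shows "contains_subgraph \<Gamma> G \<or> contains_subgraph (complement_graph \<Gamma>) (cycle_graph k)"
proof (rule ccontr)
  assume no: "\<not> ?thesis"
  obtain m where m: "k = 2 * m + 1" using k(2) by (auto elim: oddE)
  \<comment> \<open>Truncated subtraction: a tree gets \<open>l = 0\<close>.\<close>
  define l where "l = card (edges G) - n"
  define B where "B x y \<longleftrightarrow> (x, y) \<in> parcs (complement_graph \<Gamma>)" for x y
  note gc = pair_graph_complement[OF \<Gamma>(1)]
  note sG = sgraph_of_pair_graph[OF G(1)] and s\<Gamma> = sgraph_of_pair_graph[OF \<Gamma>(1)]
  note s\<Gamma>' = sgraphD[OF sgraph_of_pair_graph[OF gc]]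
  have pv: "pverts (complement_graph \<Gamma>) = pverts \<Gamma>" by (simp add: complement_graph_def)
  have l_le: "36 * (2 * m + 1)\<^sup>2 * l \<le> n"
  proof (cases "card (edges G) \<le> n")
    case True then show ?thesis by (simp add: l_def)
  next
    case False
    have k0: "real k > 0" using k by simp
    have "real l = real (card (edges G)) - real n" using False by (simp add: l_def)
    also have "\<dots> \<le> real n / (36 * (real k)\<^sup>2)" using e by (simp add: algebra_simps)
    finally have "36 * (real k)\<^sup>2 * real l \<le> real n" using k0 by (simp add: field_simps)
    then have "real (36 * k\<^sup>2 * l) \<le> real n" by simp
    then show ?thesis unfolding m by (simp only: of_nat_le_iff)
  qed
  interpret counterexample "pverts \<Gamma>" B m "pverts G" "parcs G" n l
  proof
    show "finite (pverts \<Gamma>)" using s\<Gamma> by (simp add: sgraph_def)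
    show "B y x" if "B x y" for x y using that s\<Gamma>'(3) by (simp add: B_def)
    show "\<not> B x x" for x using s\<Gamma>'(4) by (simp add: B_def)
    show "m \<ge> 1" using k m by simp
    show False if "set cs \<subseteq> pverts \<Gamma>" "distinct cs" "length cs = 2 * m + 1" "successively B cs" "B (last cs) (hd cs)" for cs
      using no contains_cycleI[OF gc k(1), of cs] that by (simp add: B_def[abs_def] pv m)
    show "sgraph (pverts G) (parcs G)" by (rule sG)
    show "connected_on (pverts G) (parcs G)" by (rule connected_on_of_connected[OF G(1,2)])
    show "card (pverts G) = n" "card (pverts \<Gamma>) = 2 * n - 1" by fact+
    show "card (parcs G) \<le> 2 * n + 2 * l" unfolding card_parcs[OF G(1)] l_def by simp
    show "n \<ge> 14 * m + 3" using n m by simp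
    show "36 * (2 * m + 1)\<^sup>2 * l \<le> n" by (rule l_le)
    show "\<not> red_emb B (pverts G) (parcs G) (pverts \<Gamma>) f" for f
    proof
      assume f: "red_emb B (pverts G) (parcs G) (pverts \<Gamma>) f"
      have "(f u, f v) \<in> parcs \<Gamma>" if uv: "(u, v) \<in> parcs G" for u v
      proof -
        have "u \<in> pverts G" "v \<in> pverts G" "u \<noteq> v" using uv sgraphD[OF sG] by auto
        then have "f u \<in> pverts \<Gamma>" "f v \<in> pverts \<Gamma>" "f u \<noteq> f v" "\<not> B (f u) (f v)"
          using f uv by (auto simp: red_emb_def dest: inj_onD)
        then show ?thesis by (simp add: B_def complement_graph_def)
      qed
      then have "contains_subgraph \<Gamma> G"
        unfolding contains_subgraph_iff[OF \<Gamma>(1) G(1)] using f by (intro exI[of _ f]) (auto simp: red_emb_def)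
      then show False using no by simp
    qed
  qed
  show False by (rule no_counterexample)
qed

text \<open>Every smaller \<open>N\<close> has to be refuted, not only \<open>2 n - 2\<close>, so
  the two cliques are cut down to \<open>N\<close> vertices: \<open>s\<close> selects the first
  \<open>n - 1\<close>, and at most \<open>n - 1\<close> others remain. The complement is bipartite
  and has no odd cycle.\<close>

lemma ramsey_lower:
  fixes G :: "'a pair_pre_digraph"
  assumes k: "k \<ge> 3" "odd k"
    and G: "pair_graph G" "Digraph_Component.connected (with_proj G)" "card (pverts G) = n" "n \<ge> 1"
    and N: "N < 2 * n - 1"
  obtains \<Gamma> :: "nat pair_pre_digraph" where "pair_graph \<Gamma>" "card (pverts \<Gamma>) = N"
    "\<not> contains_subgraph \<Gamma> G" "\<not> contains_subgraph (complement_graph \<Gamma>) (cycle_graph k)"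
proof -
  define s where "s x \<longleftrightarrow> x < n - 1" for x :: nat
  define \<Gamma> :: "nat pair_pre_digraph" where
    "\<Gamma> = \<lparr>pverts = {..<N}, parcs = {(u, v). u < N \<and> v < N \<and> u \<noteq> v \<and> (s u \<longleftrightarrow> s v)}\<rparr>"
  have "parcs \<Gamma> \<subseteq> {..<N} \<times> {..<N}" by (auto simp: \<Gamma>_def)
  then have "finite (parcs \<Gamma>)" by (meson finite_SigmaI finite_lessThan finite_subset)
  then have g\<Gamma>: "pair_graph \<Gamma>"
    by unfold_locales (auto simp: \<Gamma>_def symmetric_def intro!: symI)
  have "\<not> contains_subgraph \<Gamma> G"
  proof
    assume "contains_subgraph \<Gamma> G"
    then obtain f where f: "inj_on f (pverts G)" "f ` pverts G \<subseteq> {..<N}"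
      and "\<forall>(u, v)\<in>parcs G. (f u, f v) \<in> parcs \<Gamma>"
      unfolding contains_subgraph_iff[OF g\<Gamma> G(1)] by (auto simp: \<Gamma>_def)
    then have fs: "s (f u) \<longleftrightarrow> s (f v)" if "(u, v) \<in> parcs G" for u v
      using that by (auto simp: \<Gamma>_def)
    define S where "S = {x\<in>pverts G. s (f x)}"
    have "S \<noteq> pverts G"
    proof
      assume "S = pverts G"
      then have "f ` pverts G \<subseteq> {..<n - 1}" by (auto simp: S_def s_def)
      then have "card (f ` pverts G) \<le> n - 1" using card_mono[of "{..<n - 1}"] by fastforce
      then show False using f(1) G(3,4) by (simp add: card_image)
    qed
    moreover have "S \<noteq> {}"
    proof
      assume "S = {}"
      then have "f ` pverts G \<subseteq> {n - 1..<N}" using f(2) by (auto simp: S_def s_def not_less)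
      then have "card (f ` pverts G) \<le> N - (n - 1)" using card_mono[of "{n - 1..<N}"] by fastforce
      then show False using f(1) G(3,4) N by (simp add: card_image)
    qed
    moreover have "S \<subseteq> pverts G" by (auto simp: S_def)
    ultimately obtain u v where "u \<in> S" "v \<in> pverts G - S" "(u, v) \<in> parcs G"
      using connected_on_of_connected[OF G(1,2)] unfolding connected_on_def by blast
    then show False using fs by (auto simp: S_def)
  qed
  moreover have "\<not> contains_subgraph (complement_graph \<Gamma>) (cycle_graph k)"
  proof
    assume "contains_subgraph (complement_graph \<Gamma>) (cycle_graph k)"
    then obtain f where f: "\<forall>(i, j)\<in>parcs (cycle_graph k). (f i, f j) \<in> parcs (complement_graph \<Gamma>)"
      unfolding contains_subgraph_iff[OF pair_graph_complement[OF g\<Gamma>] pair_graph_cycle[OF k(1)]]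
      by blast
    have step: "s (f i) \<noteq> s (f ((i + 1) mod k))" if "i < k" for i
    proof -
      have "(i, (i + 1) mod k) \<in> parcs (cycle_graph k)" using that k by (simp add: cycle_graph_def)
      from bspec[OF f this] show ?thesis by (auto simp: complement_graph_def \<Gamma>_def)
    qed
    \<comment> \<open>Sides alternate along the cycle; as \<open>k - 1\<close> is even, the adjacent
      vertices \<open>f (k - 1)\<close> and \<open>f 0\<close> would lie on the same side.\<close>
    have "i < k \<Longrightarrow> s (f i) \<longleftrightarrow> (s (f 0) \<longleftrightarrow> even i)" for i
    proof (induction i)
      case (Suc i)
      then show ?case using step[of i] by auto
    qed simp
    from this[of "k - 1"] have "s (f (k - 1)) \<longleftrightarrow> s (f 0)" using k by simp
    then show False using step[of "k - 1"] k by simp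
  qed
  ultimately show thesis using g\<Gamma> that[of \<Gamma>] by (simp add: \<Gamma>_def)
qed

theorem theorem1p5:
  fixes G :: "'a pair_pre_digraph" and k n :: nat
  assumes "k \<ge> 3" and "odd k"
    and "n \<ge> 7 * k - 4"
    and "pair_graph G" and "Digraph_Component.connected (with_proj G)"
    and "card (pverts G) = n"
    and "real (card (edges G)) \<le> (1 + 1 / (36 * (real k)\<^sup>2)) * real n"
  shows "ramsey_number G (cycle_graph k) = 2 * n - 1"
  unfolding ramsey_number_def
proof (rule Least_equality)
  have "n \<ge> 1" using assms(1,3) by simp
  then show "0 < 2 * n - 1 \<and> (\<forall>\<Gamma> :: nat pair_pre_digraph. pair_graph \<Gamma> \<and> card (pverts \<Gamma>) = 2 * n - 1 \<longrightarrow>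
      contains_subgraph \<Gamma> G \<or> contains_subgraph (complement_graph \<Gamma>) (cycle_graph k))"
    using ramsey_upper[OF assms] by auto
  fix N
  assume N: "0 < N \<and> (\<forall>\<Gamma> :: nat pair_pre_digraph. pair_graph \<Gamma> \<and> card (pverts \<Gamma>) = N \<longrightarrow>
      contains_subgraph \<Gamma> G \<or> contains_subgraph (complement_graph \<Gamma>) (cycle_graph k))"
  show "2 * n - 1 \<le> N"
  proof (rule ccontr)
    assume "\<not> ?thesis"
    then have "N < 2 * n - 1" by simp
    from ramsey_lower[OF assms(1,2,4-6) \<open>n \<ge> 1\<close> this] N show False by metis
  qed
qed

end
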